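(* For a Zariski-dense set of mass distributions $(m_1,m_2,m_3)$, $m_i>0$, the sign of the Gaussian curvature of the Jacobi-Maupertuis metric $ds_J^2=U\,ds^2_{shape}$ on the pair of pants changes in a neighborhood of the Lagrange point (that is, every neighborhood of the Lagrange point contains points of positive curvature and points of negative curvature).
   Context: Three point masses $m_1,m_2,m_3>0$ have positions $x=(x_1,x_2,x_3)$, $x_i\in\mathbb{R}^2$, with $\sum m_i x_i=0$. Put $r_{ij}=|x_i-x_j|$, $U=\sum_{i<j} m_im_j/r_{ij}^2$, and $I=\sum_i m_i|x_i|^2=\sum_{i<j}m_im_jr_{ij}^2/\sum_i m_i$. Shape sphere: the set $\{\sum m_ix_i=0,\ I=1\}$ is a round unit three-sphere for the mass inner product $\langle v,w\rangle=\sum_i m_i v_i\cdot w_i$. The rotation group $SO(2)$ acts on it freely by isometries, and the quotient is a two-sphere, the shape sphere, whose points are oriented similarity classes of triangles; $ds^2_{shape}$ is the quotient (Riemannian submersion) metric, which is round of radius $1/2$. The function $U$ restricted to $I=1$ descends to the shape sphere. The pair of pants is the shape sphere minus the three binary collision points ($r_{12}=0$, $r_{23}=0$, $r_{31}=0$), on which the Jacobi-Maupertuis metric $ds^2_J=U\,ds^2_{shape}$ is defined. A Lagrange point is a point representing an equilateral triangle; there are two of them, one per orientation, exchanged by the reflection isometry, and "the Lagrange point" means either one. The set of mass distributions is the open octant of $\mathbb{R}^3$, and Zariski-dense means not contained in the zero set of a nonzero polynomial in $m_1,m_2,m_3$. *)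

theory Defs
  imports "HOL-Analysis.Analysis" "HOL-Computational_Algebra.Polynomial"
begin

section \<open>Gaussian curvature of a Riemannian metric in coordinates\<close>

definition partial :: "2 \<Rightarrow> (real^2 \<Rightarrow> 'a::real_normed_vector) \<Rightarrow> real^2 \<Rightarrow> 'a" where
  "partial i f p = vector_derivative (\<lambda>t. f (p + t *\<^sub>R axis i 1)) (at 0)"

text \<open>Christoffel symbols of the second kind; \<open>christoffel g k i j\<close> has upper index \<open>k\<close>.\<close>

definition christoffel :: "(real^2 \<Rightarrow> real^2^2) \<Rightarrow> 2 \<Rightarrow> 2 \<Rightarrow> 2 \<Rightarrow> real^2 \<Rightarrow> real" where
  "christoffel g k i j p =
     (\<Sum>l\<in>UNIV. matrix_inv (g p) $ k $ l *
        (partial i (\<lambda>q. g q $ j $ l) p + partial j (\<lambda>q. g q $ i $ l) p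
         - partial l (\<lambda>q. g q $ i $ j) p)) / 2"

text \<open>The component \<open>R\<^sup>l\<close> in \<open>R(\<partial>\<^sub>i, \<partial>\<^sub>j)\<partial>\<^sub>k = R\<^sup>l \<partial>\<^sub>l\<close>, with the convention
  \<open>R(X, Y)Z = \<nabla>\<^sub>X \<nabla>\<^sub>Y Z - \<nabla>\<^sub>Y \<nabla>\<^sub>X Z - \<nabla>\<^bsub>[X, Y]\<^esub> Z\<close>, for which round spheres have positive curvature
  below.\<close>

definition riemann :: "(real^2 \<Rightarrow> real^2^2) \<Rightarrow> 2 \<Rightarrow> 2 \<Rightarrow> 2 \<Rightarrow> 2 \<Rightarrow> real^2 \<Rightarrow> real" where
  "riemann g l k i j p =
     partial i (christoffel g l j k) p - partial j (christoffel g l i k) p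
     + (\<Sum>s\<in>UNIV. christoffel g l i s p * christoffel g s j k p
                  - christoffel g l j s p * christoffel g s i k p)"

text \<open>\<open>\<langle>R(\<partial>\<^sub>1, \<partial>\<^sub>2)\<partial>\<^sub>2, \<partial>\<^sub>1\<rangle> / det g\<close>\<close>

definition gauss_curvature :: "(real^2 \<Rightarrow> real^2^2) \<Rightarrow> real^2 \<Rightarrow> real" where
  "gauss_curvature g p = (\<Sum>l\<in>UNIV. g p $ 1 $ l * riemann g l 2 1 2 p) / det (g p)"


section \<open>Planar three-body configurations\<close>

type_synonym masses = "real^3"
type_synonym config = "(real^2)^3"

definition mass_octant :: "masses set" where
  "mass_octant = {m. \<forall>i. 0 < m $ i}"

definition mass_inner :: "masses \<Rightarrow> config \<Rightarrow> config \<Rightarrow> real" where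
  "mass_inner m v w = (\<Sum>i\<in>UNIV. m $ i * (v $ i \<bullet> w $ i))"

definition inertia :: "masses \<Rightarrow> config \<Rightarrow> real" where
  "inertia m x = (\<Sum>i\<in>UNIV. m $ i * (norm (x $ i))\<^sup>2)"

definition potential :: "masses \<Rightarrow> config \<Rightarrow> real" where
  "potential m x = m $ 1 * m $ 2 / (dist (x $ 1) (x $ 2))\<^sup>2
                 + m $ 2 * m $ 3 / (dist (x $ 2) (x $ 3))\<^sup>2
                 + m $ 3 * m $ 1 / (dist (x $ 3) (x $ 1))\<^sup>2"

definition collision :: "config \<Rightarrow> bool" where
  "collision x \<longleftrightarrow> x $ 1 = x $ 2 \<or> x $ 2 = x $ 3 \<or> x $ 3 = x $ 1"

definition equilateral :: "config \<Rightarrow> bool" where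
  "equilateral x \<longleftrightarrow> dist (x $ 1) (x $ 2) = dist (x $ 2) (x $ 3)
                   \<and> dist (x $ 2) (x $ 3) = dist (x $ 3) (x $ 1)"

definition config_sphere :: "masses \<Rightarrow> config set" where
  "config_sphere m = {x. (\<Sum>i\<in>UNIV. m $ i *\<^sub>R x $ i) = 0 \<and> inertia m x = 1}"

definition quarter_turn :: "real^2 \<Rightarrow> real^2" where
  "quarter_turn v = vector [- v $ 2, v $ 1]"

definition rot :: "real \<Rightarrow> config \<Rightarrow> config" where
  "rot \<theta> x = (\<chi> i. cos \<theta> *\<^sub>R x $ i + sin \<theta> *\<^sub>R quarter_turn (x $ i))"


section \<open>The shape sphere\<close>

definition shape_of :: "config \<Rightarrow> config set" where
  "shape_of x = range (\<lambda>\<theta>. rot \<theta> x)"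

definition shape_sphere :: "masses \<Rightarrow> config set set" where
  "shape_sphere m = shape_of ` config_sphere m"

text \<open>The quotient topology.\<close>

definition shape_topology :: "masses \<Rightarrow> config set topology" where
  "shape_topology m = topology (\<lambda>N. N \<subseteq> shape_sphere m \<and>
     openin (top_of_set (config_sphere m)) {x \<in> config_sphere m. shape_of x \<in> N})"

definition pants :: "masses \<Rightarrow> config set set" where
  "pants m = shape_of ` {x \<in> config_sphere m. \<not> collision x}"

definition lagrange_points :: "masses \<Rightarrow> config set set" where
  "lagrange_points m = shape_of ` {x \<in> config_sphere m. equilateral x}"

lemma openin_shape_topology:
  "openin (shape_topology m) N \<longleftrightarrow> N \<subseteq> shape_sphere m \<and>
     openin (top_of_set (config_sphere m)) {x \<in> config_sphere m. shape_of x \<in> N}"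
proof -
  let ?P = "\<lambda>N. N \<subseteq> shape_sphere m \<and>
     openin (top_of_set (config_sphere m)) {x \<in> config_sphere m. shape_of x \<in> N}"
  have "istopology ?P"
    unfolding istopology_def
  proof (intro conjI allI impI)
    fix S T assume S: "?P S" and T: "?P T"
    have eq: "{x \<in> config_sphere m. shape_of x \<in> S \<inter> T}
      = {x \<in> config_sphere m. shape_of x \<in> S} \<inter> {x \<in> config_sphere m. shape_of x \<in> T}"
      by auto
    show "S \<inter> T \<subseteq> shape_sphere m" using S by auto
    show "openin (top_of_set (config_sphere m)) {x \<in> config_sphere m. shape_of x \<in> S \<inter> T}"
      unfolding eq using S T by (blast intro: openin_Int)
  next
    fix \<K> assume K: "\<forall>K\<in>\<K>. ?P K"
    have eq: "{x \<in> config_sphere m. shape_of x \<in> \<Union>\<K>}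
      = \<Union>((\<lambda>K. {x \<in> config_sphere m. shape_of x \<in> K}) ` \<K>)"
      by auto
    show "\<Union>\<K> \<subseteq> shape_sphere m" using K by auto
    show "openin (top_of_set (config_sphere m)) {x \<in> config_sphere m. shape_of x \<in> \<Union>\<K>}"
      unfolding eq using K by (intro openin_Union) auto
  qed
  then show ?thesis
    unfolding shape_topology_def by (simp add: topology_inverse')
qed


section \<open>A global chart of the pair of pants\<close>

text \<open>Away from collisions a shape has a unique similar triangle with vertices \<open>0\<close>, \<open>(1, 0)\<close>, \<open>p\<close>
  (in this order), and \<open>p\<close> is the coordinate of the shape.  \<open>lift m p\<close> is a representative in the
  three-sphere.\<close>

definition chart_domain :: "(real^2) set" where
  "chart_domain = UNIV - {0, axis 1 1}"

definition triangle :: "real^2 \<Rightarrow> config" where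
  "triangle p = vector [0, axis 1 1, p]"

definition centered :: "masses \<Rightarrow> config \<Rightarrow> config" where
  "centered m x = (\<chi> i. x $ i - (\<Sum>j\<in>UNIV. m $ j *\<^sub>R x $ j) /\<^sub>R (\<Sum>j\<in>UNIV. m $ j))"

definition lift :: "masses \<Rightarrow> real^2 \<Rightarrow> config" where
  "lift m p = (let y = centered m (triangle p) in y /\<^sub>R sqrt (inertia m y))"

definition chart_point :: "masses \<Rightarrow> real^2 \<Rightarrow> config set" where
  "chart_point m p = shape_of (lift m p)"

definition chart_coord :: "masses \<Rightarrow> config set \<Rightarrow> real^2" where
  "chart_coord m = the_inv_into chart_domain (chart_point m)"

lemma quarter_turn_nth [simp]: "quarter_turn v $ 1 = - v $ 2" "quarter_turn v $ 2 = v $ 1"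
  by (simp_all add: quarter_turn_def)

lemma linear_quarter_turn: "linear quarter_turn"
  by (rule linearI) (simp_all add: vec_eq_iff forall_2)

lemma linear_rot: "linear (rot \<theta>)"
proof (rule linearI)
  interpret q: linear quarter_turn by (rule linear_quarter_turn)
  show "rot \<theta> (x + y) = rot \<theta> x + rot \<theta> y" for x y
    by (simp add: rot_def vec_eq_iff q.add algebra_simps)
  show "rot \<theta> (c *\<^sub>R x) = c *\<^sub>R rot \<theta> x" for c x
    by (simp add: rot_def vec_eq_iff q.scale algebra_simps)
qed

lemma rot_rot: "rot \<alpha> (rot \<beta> x) = rot (\<alpha> + \<beta>) x"
  by (simp add: rot_def vec_eq_iff forall_2 cos_add sin_add algebra_simps)

lemma rot_0: "rot 0 x = x"
  by (simp add: rot_def)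

lemma shape_of_rot: "shape_of (rot \<theta> x) = shape_of x"
proof -
  have "range (\<lambda>\<alpha>. rot (\<alpha> + \<theta>) x) = range (\<lambda>\<alpha>. rot \<alpha> x)"
    by (auto simp: image_iff) (metis diff_add_cancel)
  then show ?thesis by (simp add: shape_of_def rot_rot)
qed

lemma inertia_scale: "inertia m (c *\<^sub>R x) = c\<^sup>2 * inertia m x"
  by (simp add: inertia_def sum_distrib_left power_mult_distrib algebra_simps)

lemma inertia_rot: "inertia m (rot \<theta> x) = inertia m x"
proof -
  have gen: "(norm (c *\<^sub>R v + s *\<^sub>R quarter_turn v))\<^sup>2 = (c\<^sup>2 + s\<^sup>2) * (norm v)\<^sup>2"
    for c s and v :: "real^2"
    unfolding power2_norm_eq_inner
    by (simp add: inner_vec_def sum_2 power2_eq_square algebra_simps)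
  have "(norm (cos \<theta> *\<^sub>R v + sin \<theta> *\<^sub>R quarter_turn v))\<^sup>2 = (norm v)\<^sup>2" for v :: "real^2"
    unfolding gen by simp
  then show ?thesis by (simp add: inertia_def rot_def)
qed

lemma triangle_nth [simp]:
  "triangle p $ 1 = 0" "triangle p $ 2 = axis 1 1" "triangle p $ 3 = p"
  by (simp_all add: triangle_def)

lemma centered_diff: "centered m x $ i - centered m x $ j = x $ i - x $ j"
  by (simp add: centered_def)

lemma mass_sum_centered:
  assumes "m \<in> mass_octant"
  shows "(\<Sum>i\<in>UNIV. m $ i *\<^sub>R centered m x $ i) = 0"
proof -
  have M: "(\<Sum>j\<in>UNIV. m $ j) > 0" using assms by (intro sum_pos) (auto simp: mass_octant_def)
  let ?c = "(\<Sum>j\<in>UNIV. m $ j *\<^sub>R x $ j) /\<^sub>R (\<Sum>j\<in>UNIV. m $ j)"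
  have "(\<Sum>i\<in>UNIV. m $ i *\<^sub>R centered m x $ i)
      = (\<Sum>i\<in>UNIV. m $ i *\<^sub>R x $ i) - (\<Sum>i\<in>UNIV. m $ i *\<^sub>R ?c)"
    by (simp only: centered_def vec_lambda_beta scaleR_diff_right sum_subtractf)
  also have "(\<Sum>i\<in>UNIV. m $ i *\<^sub>R ?c) = (\<Sum>i\<in>UNIV. m $ i) *\<^sub>R ?c"
    by (simp only: scaleR_left.sum)
  also have "\<dots> = (\<Sum>i\<in>UNIV. m $ i *\<^sub>R x $ i)" using M by simp
  finally show ?thesis by simp
qed

lemma inertia_centered_triangle_pos:
  assumes "m \<in> mass_octant"
  shows "inertia m (centered m (triangle p)) > 0"
proof (rule ccontr)
  let ?y = "centered m (triangle p)"
  assume "\<not> inertia m ?y > 0"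
  moreover have nn: "\<forall>i. m $ i * (norm (?y $ i))\<^sup>2 \<ge> 0"
    using assms by (auto simp: mass_octant_def less_imp_le)
  moreover have "inertia m ?y \<ge> 0"
    unfolding inertia_def using nn by (intro sum_nonneg) auto
  ultimately have "inertia m ?y = 0" by linarith
  then have "\<forall>i. m $ i * (norm (?y $ i))\<^sup>2 = 0"
    using nn unfolding inertia_def by (subst (asm) sum_nonneg_eq_0_iff) auto
  then have "?y $ 2 - ?y $ 1 = 0"
    using assms unfolding mass_octant_def by (auto simp: less_le)
  then show False by (simp add: centered_diff axis_eq_0_iff)
qed

lemma lift_diff:
  assumes "m \<in> mass_octant"
  obtains c where "c > 0" "\<And>i j. lift m p $ i - lift m p $ j = c *\<^sub>R (triangle p $ i - triangle p $ j)"
proof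
  let ?y = "centered m (triangle p)"
  show "1 / sqrt (inertia m ?y) > 0" using inertia_centered_triangle_pos[OF assms] by simp
  show "lift m p $ i - lift m p $ j = (1 / sqrt (inertia m ?y)) *\<^sub>R (triangle p $ i - triangle p $ j)"
    for i j
    by (simp add: lift_def Let_def centered_diff divide_inverse flip: scaleR_diff_right)
qed

lemma lift_in_config_sphere:
  assumes "m \<in> mass_octant"
  shows "lift m p \<in> config_sphere m"
proof -
  let ?y = "centered m (triangle p)"
  have "(\<Sum>i\<in>UNIV. m $ i *\<^sub>R lift m p $ i) = (\<Sum>i\<in>UNIV. m $ i *\<^sub>R ?y $ i) /\<^sub>R sqrt (inertia m ?y)"
    by (simp add: lift_def Let_def scaleR_sum_right mult.commute)
  then have "(\<Sum>i\<in>UNIV. m $ i *\<^sub>R lift m p $ i) = 0" by (simp only: mass_sum_centered[OF assms]) simp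
  moreover have "inertia m (lift m p) = 1"
    using inertia_centered_triangle_pos[OF assms, of p]
    by (simp add: lift_def Let_def inertia_scale power_inverse)
  ultimately show ?thesis by (simp add: config_sphere_def)
qed

lemma bij_betw_chart_point:
  assumes m: "m \<in> mass_octant"
  shows "bij_betw (chart_point m) chart_domain (pants m)"
  unfolding bij_betw_def
proof (intro conjI set_eqI iffI)
  show "inj_on (chart_point m) chart_domain"
  proof (rule inj_onI)
    fix p q assume "chart_point m p = chart_point m q"
    moreover have "lift m p \<in> chart_point m p"
      unfolding chart_point_def shape_of_def by (rule range_eqI[of _ _ 0]) (simp add: rot_0)
    ultimately obtain \<theta> where \<theta>: "lift m p = rot \<theta> (lift m q)"
      by (auto simp: chart_point_def shape_of_def)
    obtain c where c: "c > 0"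
      "\<And>i j. lift m p $ i - lift m p $ j = c *\<^sub>R (triangle p $ i - triangle p $ j)"
      using lift_diff[OF m] by blast
    obtain d where d: "d > 0"
      "\<And>i j. lift m q $ i - lift m q $ j = d *\<^sub>R (triangle q $ i - triangle q $ j)"
      using lift_diff[OF m] by blast
    interpret qt: linear quarter_turn by (rule linear_quarter_turn)
    have eq: "c *\<^sub>R (triangle p $ i - triangle p $ j) =
      d *\<^sub>R (cos \<theta> *\<^sub>R (triangle q $ i - triangle q $ j)
             + sin \<theta> *\<^sub>R quarter_turn (triangle q $ i - triangle q $ j))" for i j
    proof -
      have "rot \<theta> x $ i - rot \<theta> x $ j =
        cos \<theta> *\<^sub>R (x $ i - x $ j) + sin \<theta> *\<^sub>R quarter_turn (x $ i - x $ j)" for x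
        by (simp add: rot_def qt.diff algebra_simps)
      then have "lift m p $ i - lift m p $ j =
        cos \<theta> *\<^sub>R (lift m q $ i - lift m q $ j) + sin \<theta> *\<^sub>R quarter_turn (lift m q $ i - lift m q $ j)"
        by (simp add: \<theta>)
      then show ?thesis unfolding c(2) d(2) qt.scale by (simp add: algebra_simps)
    qed
    from eq[of 2 1] have "c = d * cos \<theta>" "d * sin \<theta> = 0"
      by (simp_all add: vec_eq_iff forall_2 axis_def)
    moreover from this have "sin \<theta> = 0" using d by simp
    ultimately show "p = q"
      using eq[of 3 1] c(1) by auto
  qed
next
  fix s assume "s \<in> chart_point m ` chart_domain"
  then obtain p where p: "p \<noteq> 0" "p \<noteq> axis 1 1" "s = shape_of (lift m p)"
    by (auto simp: chart_domain_def chart_point_def)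
  obtain c where c: "c > 0"
      "\<And>i j. lift m p $ i - lift m p $ j = c *\<^sub>R (triangle p $ i - triangle p $ j)"
      using lift_diff[OF m] by blast
  have "\<not> collision (lift m p)"
    using c(2)[of 1 2] c(2)[of 2 3] c(2)[of 3 1] c(1) p
    by (auto simp: collision_def axis_eq_0_iff)
  then show "s \<in> pants m" using p lift_in_config_sphere[OF m] by (auto simp: pants_def)
next
  fix s assume "s \<in> pants m"
  then obtain x where x: "x \<in> config_sphere m" "\<not> collision x" "s = shape_of x"
    by (auto simp: pants_def)
  define d where "d = x $ 2 - x $ 1"
  define e where "e = x $ 3 - x $ 1"
  define r where "r = norm d"
  have "d \<noteq> 0" using x(2) by (auto simp: d_def collision_def)
  then have r: "r > 0" by (simp add: r_def)
  have r2: "r\<^sup>2 = (d $ 1)\<^sup>2 + (d $ 2)\<^sup>2"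
    unfolding r_def power2_norm_eq_inner by (simp add: inner_vec_def sum_2 power2_eq_square)
  have "(d $ 1 / r)\<^sup>2 + (d $ 2 / r)\<^sup>2 = 1"
    using r by (simp add: power_divide r2[symmetric] flip: add_divide_distrib)
  then obtain \<theta> where \<theta>: "d $ 1 / r = cos \<theta>" "d $ 2 / r = sin \<theta>"
    using sincos_total_2pi by metis
  have dcs: "d $ 1 = r * cos \<theta>" "d $ 2 = r * sin \<theta>" using \<theta> r by (auto simp: field_simps)
  define p :: "real^2" where
    "p = vector [(cos \<theta> * e $ 1 + sin \<theta> * e $ 2) / r, (cos \<theta> * e $ 2 - sin \<theta> * e $ 1) / r]"
  define a where "a = r *\<^sub>R rot \<theta> (triangle p)"
  have a: "a $ 1 = 0" "a $ 2 = d" "a $ 3 = e"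
  proof -
    show "a $ 1 = 0" "a $ 2 = d"
      by (simp_all add: a_def rot_def vec_eq_iff forall_2 axis_def dcs)
    have rp: "r * p $ 1 = cos \<theta> * e $ 1 + sin \<theta> * e $ 2" "r * p $ 2 = cos \<theta> * e $ 2 - sin \<theta> * e $ 1"
      using r by (simp_all add: p_def)
    have "a $ 3 $ 1 = cos \<theta> * (r * p $ 1) - sin \<theta> * (r * p $ 2)"
      "a $ 3 $ 2 = cos \<theta> * (r * p $ 2) + sin \<theta> * (r * p $ 1)"
      by (simp_all add: a_def rot_def right_diff_distrib distrib_left mult.left_commute)
    then have "a $ 3 $ 1 = e $ 1" "a $ 3 $ 2 = e $ 2"
      unfolding rp using sin_cos_squared_add2[of \<theta>] by algebra+
    then show "a $ 3 = e" by (simp add: vec_eq_iff forall_2)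
  qed
  have "\<forall>i. x $ i = x $ 1 + a $ i"
    unfolding forall_3 by (simp add: a d_def e_def)
  then have xa: "x $ i = x $ 1 + a $ i" for i by blast
  let ?M = "\<Sum>j\<in>UNIV. m $ j"
  have M: "?M > 0" using m by (intro sum_pos) (auto simp: mass_octant_def)
  have "0 = (\<Sum>i\<in>UNIV. m $ i *\<^sub>R x $ i)" using x(1) by (simp add: config_sphere_def)
  also have "\<dots> = (\<Sum>i\<in>UNIV. m $ i *\<^sub>R (x $ 1 + a $ i))" by (intro sum.cong refl) (metis xa)
  also have "\<dots> = ?M *\<^sub>R x $ 1 + (\<Sum>i\<in>UNIV. m $ i *\<^sub>R a $ i)"
    by (simp add: scaleR_add_right sum.distrib scaleR_left.sum)
  finally have Mx: "(\<Sum>i\<in>UNIV. m $ i *\<^sub>R a $ i) = - (?M *\<^sub>R x $ 1)"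
    by (simp add: eq_neg_iff_add_eq_0 add.commute)
  have x1: "- ((\<Sum>i\<in>UNIV. m $ i *\<^sub>R a $ i) /\<^sub>R ?M) = x $ 1"
    unfolding Mx using M by simp
  have "x $ i = a $ i - (\<Sum>i\<in>UNIV. m $ i *\<^sub>R a $ i) /\<^sub>R ?M" for i
    unfolding diff_conv_add_uminus x1 by (subst xa) (rule add.commute)
  then have xc: "x = centered m a"
    by (simp add: centered_def vec_eq_iff)
  define y where "y = centered m (triangle p)"
  have "linear (centered m)"
    by (rule linearI)
      (simp_all add: centered_def vec_eq_iff sum.distrib algebra_simps sum_distrib_left)
  then have "centered m a = r *\<^sub>R centered m (rot \<theta> (triangle p))"
    by (simp add: a_def linear_scale)
  also have "centered m (rot \<theta> (triangle p)) = rot \<theta> y"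
    by (simp add: y_def centered_def rot_def vec_eq_iff forall_2 sum_3 algebra_simps)
  finally have "centered m a = r *\<^sub>R rot \<theta> y" .
  with xc have xy: "x = r *\<^sub>R rot \<theta> y" by simp
  have "r\<^sup>2 * inertia m y = 1"
    using x(1) unfolding xy by (simp add: config_sphere_def inertia_scale inertia_rot)
  then have "inertia m y = (1 / r)\<^sup>2" using r by (simp add: field_simps)
  then have "lift m p = r *\<^sub>R y"
    using r by (simp add: lift_def y_def[symmetric] real_sqrt_divide)
  then have xl: "x = rot \<theta> (lift m p)" unfolding xy by (simp add: linear_scale[OF linear_rot])
  have "p \<noteq> 0" using x(2) a(3) by (auto simp: collision_def a_def rot_def e_def vec_eq_iff forall_2)
  moreover have "p \<noteq> axis 1 1"
  proof
    assume "p = axis 1 1"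
    then have "a $ 3 = a $ 2" by (simp add: a_def rot_def)
    then show False using x(2) a by (simp add: d_def e_def collision_def)
  qed
  ultimately have "p \<in> chart_domain" by (simp add: chart_domain_def)
  moreover have "s = chart_point m p" unfolding x(3) chart_point_def by (subst xl) (rule shape_of_rot)
  ultimately show "s \<in> chart_point m ` chart_domain" by blast
qed


section \<open>The Jacobi-Maupertuis metric\<close>

definition rot_field :: "config \<Rightarrow> config" where
  "rot_field x = (\<chi> i. quarter_turn (x $ i))"

text \<open>Component of \<open>v\<close> orthogonal to the orbit through \<open>x\<close>, for the mass inner product.\<close>

definition horizontal :: "masses \<Rightarrow> config \<Rightarrow> config \<Rightarrow> config" where
  "horizontal m x v =
     v - (mass_inner m v (rot_field x) / mass_inner m (rot_field x) (rot_field x)) *\<^sub>R rot_field x"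

text \<open>The coefficients in the chart of the metric for which \<^term>\<open>shape_of\<close> is a Riemannian
  submersion: the coordinate vectors are the images of the derivatives of \<open>lift m\<close>, and the length of
  an image is the length of the horizontal part.\<close>

definition shape_metric :: "masses \<Rightarrow> real^2 \<Rightarrow> real^2^2" where
  "shape_metric m p = (\<chi> i j. mass_inner m
     (horizontal m (lift m p) (partial i (lift m) p))
     (horizontal m (lift m p) (partial j (lift m) p)))"

definition jacobi_metric :: "masses \<Rightarrow> real^2 \<Rightarrow> real^2^2" where
  "jacobi_metric m p = potential m (lift m p) *\<^sub>R shape_metric m p"

definition jacobi_curvature :: "masses \<Rightarrow> config set \<Rightarrow> real" where
  "jacobi_curvature m s = gauss_curvature (jacobi_metric m) (chart_coord m s)"

definition curvature_changes_sign_at :: "masses \<Rightarrow> config set \<Rightarrow> bool" where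
  "curvature_changes_sign_at m L \<longleftrightarrow>
     (\<forall>N. openin (shape_topology m) N \<and> L \<in> N \<longrightarrow>
        (\<exists>s \<in> N \<inter> pants m. jacobi_curvature m s > 0) \<and>
        (\<exists>s \<in> N \<inter> pants m. jacobi_curvature m s < 0))"


section \<open>Zariski density\<close>

text \<open>A polynomial in three variables is an element of \<open>\<real>[X\<^sub>1][X\<^sub>2][X\<^sub>3]\<close>; the outermost variable is
  \<open>X\<^sub>3\<close>.\<close>

definition eval3 :: "real poly poly poly \<Rightarrow> real^3 \<Rightarrow> real" where
  "eval3 P m = poly (poly (poly P [:[:m $ 3:]:]) [:m $ 2:]) (m $ 1)"

definition zariski_dense :: "(real^3) set \<Rightarrow> bool" where
  "zariski_dense D \<longleftrightarrow> \<not> (\<exists>P. P \<noteq> 0 \<and> D \<subseteq> {m. eval3 P m = 0})"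

end

theory Submission
  imports Defs
begin

text \<open>Write \<open>A = m\<^sub>1 m\<^sub>2\<close>, \<open>B = m\<^sub>2 m\<^sub>3\<close>, \<open>C = m\<^sub>3 m\<^sub>1\<close>.  In the chart, where a shape is the similar triangle with
  vertices \<open>0\<close>, \<open>(1, 0)\<close>, \<open>p\<close>, the squared side lengths are \<open>1\<close>, \<open>s = |p - (1, 0)|\<^sup>2\<close> and \<open>t = |p|\<^sup>2\<close>.  The normalised
  lift moves in the complex span of the centred triangle \<open>y\<close> and of one fixed vector, so the submersion
  metric is of Fubini-Study type: it is conformal, with factor a constant divided by the square of
  the moment of inertia \<open>G / M\<close>, where \<open>M\<close> is the total mass and \<open>G = A + B s + C t\<close> (\<open>shape_metric_eq\<close>).
  The potential on the unit sphere is \<open>G V / M\<close> with \<open>V = A + B / s + C / t\<close>, hence the Jacobi-Maupertuis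
  metric is \<open>m\<^sub>1 m\<^sub>2 m\<^sub>3 (V / G) |dp|\<^sup>2\<close> (\<open>jacobi_metric_eq\<close>).

  For a conformal factor \<open>\<lambda>\<close> the curvature is \<open>- \<Delta> ln \<lambda> / (2 \<lambda>)\<close> (\<open>gauss_curvature_conformal\<close>), and here
  \<open>G \<Delta>G - |\<nabla>G|\<^sup>2 = 4 \<sigma>\<close> and \<open>V \<Delta>V - |\<nabla>V|\<^sup>2 = 4 \<tau>\<close> with \<open>\<sigma> = A B + B C + C A\<close> and
  \<open>\<tau> = A B / s\<^sup>2 + C A / t\<^sup>2 + B C / (s\<^sup>2 t\<^sup>2)\<close>.  So the curvature has the sign of \<open>\<sigma> V\<^sup>2 - \<tau> G\<^sup>2\<close>, a function of the side
  lengths only (\<open>gauss_curvature_sides_metric\<close>).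

  At a Lagrange point, \<open>s = t = 1\<close>, this function vanishes for all masses because there \<open>V = G\<close> and
  \<open>\<sigma> = \<tau>\<close>.  Its partial derivative in \<open>s\<close> is \<open>2 (A + B + C) B (A\<^sup>2 + C\<^sup>2 - B (A + C))\<close>
  (\<open>curvature_numerator_derivative\<close>); where the last factor is nonzero, the curvature takes
  both signs arbitrarily close to the point.  Up to the positive factor \<open>m\<^sub>1\<close>, the last factor
  is \<open>m\<^sub>1 (m\<^sub>2\<^sup>2 + m\<^sub>3\<^sup>2) - m\<^sub>2 m\<^sub>3 (m\<^sub>2 + m\<^sub>3)\<close>, which for given \<open>m\<^sub>2, m\<^sub>3 > 0\<close> excludes one value of \<open>m\<^sub>1\<close>.  What is
  left of the octant is Zariski-dense (\<open>zariski_dense_if_infinite_fibres\<close>).\<close>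

section \<open>Zariski density from infinite fibres\<close>

lemma poly_poly_eq_0_if_infinite_constant_roots:
  fixes q :: "'a::idom poly poly"
  assumes "infinite {b. poly q [:b:] = 0}"
  shows "q = 0"
proof (rule ccontr)
  assume "q \<noteq> 0"
  then have "finite {x. poly q x = 0}" by (rule poly_roots_finite)
  moreover have "(\<lambda>b. [:b:]) ` {b. poly q [:b:] = 0} \<subseteq> {x. poly q x = 0}" by auto
  ultimately have "finite ((\<lambda>b. [:b:]) ` {b. poly q [:b:] = 0})" by (rule rev_finite_subset)
  then show False using assms by (auto dest!: finite_imageD simp: inj_on_def)
qed

text \<open>A polynomial vanishing on \<open>D\<close> is killed one variable at a time: along an infinite fibre in the
  first variable it vanishes identically in that variable, and then its coefficients have infinitely
  many constant roots in the next one.\<close>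

lemma zariski_dense_if_infinite_fibres:
  assumes "infinite {c. infinite {b. infinite {a. vector [a, b, c] \<in> D}}}"
  shows "zariski_dense D"
  unfolding zariski_dense_def
proof (intro notI, elim exE conjE)
  fix P assume "P \<noteq> 0" and D: "D \<subseteq> {m. eval3 P m = 0}"
  have b: "poly (poly P [:[:c:]:]) [:b:] = 0" if "infinite {a. vector [a, b, c] \<in> D}" for b c
  proof (rule ccontr)
    assume "poly (poly P [:[:c:]:]) [:b:] \<noteq> 0"
    then have "finite {a. poly (poly (poly P [:[:c:]:]) [:b:]) a = 0}" by (rule poly_roots_finite)
    moreover have "{a. vector [a, b, c] \<in> D} \<subseteq> {a. poly (poly (poly P [:[:c:]:]) [:b:]) a = 0}"
      using D by (auto simp: eval3_def)
    ultimately show False using that finite_subset by blast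
  qed
  have c: "poly P [:[:c:]:] = 0" if "infinite {b. infinite {a. vector [a, b, c] \<in> D}}" for c
    by (rule poly_poly_eq_0_if_infinite_constant_roots, rule infinite_super[OF _ that])
      (use b in auto)
  have "finite {q. poly P q = 0}" using \<open>P \<noteq> 0\<close> by (rule poly_roots_finite)
  moreover have "(\<lambda>c. [:[:c:]:]) ` {c. infinite {b. infinite {a. vector [a, b, c] \<in> D}}}
      \<subseteq> {q. poly P q = 0}"
    using c by auto
  ultimately have "finite ((\<lambda>c. [:[:c:]:]) ` {c. infinite {b. infinite {a. vector [a, b, c] \<in> D}}})"
    by (rule rev_finite_subset)
  then show False using assms by (auto dest!: finite_imageD simp: inj_on_def)
qed

section \<open>Partial derivatives and conformal metrics in the plane\<close>

text \<open>\<^const>\<open>partial\<close> has a value for any function; this relation also asserts that the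
  derivative exists, which is what the calculus rules need.\<close>

definition has_partial :: "(real^2 \<Rightarrow> 'a::real_normed_vector) \<Rightarrow> 2 \<Rightarrow> 'a \<Rightarrow> real^2 \<Rightarrow> bool" where
  "has_partial f i d p \<longleftrightarrow> ((\<lambda>t. f (p + t *\<^sub>R axis i 1)) has_vector_derivative d) (at 0)"

lemma partial_eqI: "has_partial f i d p \<Longrightarrow> partial i f p = d"
  by (simp add: has_partial_def partial_def vector_derivative_at)

text \<open>The curvature differentiates the Christoffel symbols, which are computed pointwise; a formula
  valid on an open set may be differentiated in their place.\<close>

lemma has_partial_cong_open:
  assumes "has_partial f i d p" "open S" "p \<in> S" "\<And>q. q \<in> S \<Longrightarrow> f q = g q"
  shows "has_partial g i d p"
proof -
  let ?T = "(\<lambda>t::real. p + t *\<^sub>R axis i 1) -` S"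
  have "open ?T" using assms(2) by (intro open_vimage continuous_intros)
  moreover have "0 \<in> ?T" using assms(3) by simp
  ultimately show ?thesis
    using assms(1,4) unfolding has_partial_def
    by (auto elim: has_vector_derivative_transform_within_open)
qed

lemma has_partial_const: "has_partial (\<lambda>q. c) i 0 p"
  by (simp add: has_partial_def)

lemma has_partial_scaleR:
  fixes c :: real
  shows "has_partial f i d p \<Longrightarrow> has_partial (\<lambda>q. c *\<^sub>R f q) i (c *\<^sub>R d) p"
  unfolding has_partial_def by (auto intro!: derivative_eq_intros)

lemma matrix_inv_scaleR_mat_1:
  fixes c :: real
  assumes "c \<noteq> 0"
  shows "matrix_inv (c *\<^sub>R mat 1 :: real^2^2) = (1 / c) *\<^sub>R mat 1"
proof -
  have 1: "(c *\<^sub>R mat 1 :: real^2^2) ** ((1 / c) *\<^sub>R mat 1) = mat 1"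
      "((1 / c) *\<^sub>R mat 1 :: real^2^2) ** (c *\<^sub>R mat 1) = mat 1"
    using assms by (simp_all add: vec_eq_iff forall_2 matrix_matrix_mult_def sum_2 mat_def)
  then have "matrix_inv (c *\<^sub>R mat 1 :: real^2^2) ** (c *\<^sub>R mat 1) = mat 1"
    unfolding matrix_inv_def by (metis (mono_tags, lifting) someI_ex)
  then have "matrix_inv (c *\<^sub>R mat 1 :: real^2^2) ** (c *\<^sub>R mat 1) ** ((1 / c) *\<^sub>R mat 1)
      = mat 1 ** ((1 / c) *\<^sub>R mat 1)" by simp
  then show ?thesis by (simp only: matrix_mul_assoc[symmetric] 1) simp
qed

text \<open>Here \<open>\<phi>\<close> is the gradient of \<open>ln lam\<close>.  Working with the logarithmic derivative removes the factor
  \<open>lam\<close> against the inverse metric, so that the symbols are linear in \<open>\<phi>\<close>.\<close>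

lemma christoffel_conformal:
  assumes "lam p > 0" "\<And>i. has_partial lam i (lam p * \<phi> i p) p"
  shows "christoffel (\<lambda>q. lam q *\<^sub>R mat 1) k i j p =
    ((if j = k then \<phi> i p else 0) + (if i = k then \<phi> j p else 0)
      - (if i = j then \<phi> k p else 0)) / 2"
proof -
  have d: "partial i (\<lambda>q. (lam q *\<^sub>R mat 1 :: real^2^2) $ j $ l) p
      = (if j = l then lam p * \<phi> i p else 0)" for i j l
    using partial_eqI[OF assms(2), of i] partial_eqI[OF has_partial_const, of i "0::real" p]
    by (simp add: mat_def)
  have "lam p \<noteq> 0" using assms(1) by simp
  then have inv: "matrix_inv (lam p *\<^sub>R mat 1 :: real^2^2) $ k $ l = (if k = l then 1 / lam p else 0)"
    for k l
    by (simp add: matrix_inv_scaleR_mat_1) (simp add: mat_def)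
  have "\<forall>k i j. christoffel (\<lambda>q. lam q *\<^sub>R mat 1) k i j p =
    ((if j = k then \<phi> i p else 0) + (if i = k then \<phi> j p else 0)
      - (if i = j then \<phi> k p else 0)) / 2"
    unfolding christoffel_def d inv sum_2 forall_2 using \<open>lam p \<noteq> 0\<close> by (simp add: field_simps)
  then show ?thesis by blast
qed

text \<open>This is \<open>K = - \<Delta> ln lam / (2 lam)\<close>: with \<open>\<psi> i\<close> the second derivatives of \<open>ln lam\<close>, the quadratic
  terms in the Christoffel symbols cancel and only the Laplacian survives.\<close>

lemma gauss_curvature_conformal:
  fixes lam :: "real^2 \<Rightarrow> real"
  assumes S: "open S" "p \<in> S"
    and pos: "\<And>q. q \<in> S \<Longrightarrow> lam q > 0"
    and d1: "\<And>q i. q \<in> S \<Longrightarrow> has_partial lam i (lam q * \<phi> i q) q"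
    and d2: "\<And>i. has_partial (\<phi> i) i (\<psi> i) p"
  shows "gauss_curvature (\<lambda>q. lam q *\<^sub>R mat 1) p = - (\<psi> 1 + \<psi> 2) / (2 * lam p)"
proof -
  let ?g = "\<lambda>q. lam q *\<^sub>R mat 1 :: real^2^2"
  have G: "christoffel ?g k i j q = ((if j = k then \<phi> i q else 0) + (if i = k then \<phi> j q else 0)
      - (if i = j then \<phi> k q else 0)) / 2" if "q \<in> S" for k i j q
    using christoffel_conformal[where \<phi>=\<phi>, OF pos[OF that] d1[OF that]] .
  have "has_partial (christoffel ?g 1 2 2) 1 ((- 1 / 2) *\<^sub>R \<psi> 1) p"
    by (rule has_partial_cong_open[OF has_partial_scaleR[OF d2] S]) (simp add: G)
  moreover have "has_partial (christoffel ?g 1 1 2) 2 ((1 / 2) *\<^sub>R \<psi> 2) p"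
    by (rule has_partial_cong_open[OF has_partial_scaleR[OF d2] S]) (simp add: G)
  ultimately have "riemann ?g 1 2 1 2 p = - (\<psi> 1 + \<psi> 2) / 2"
    using S(2) unfolding riemann_def
    by (simp add: partial_eqI G sum_2 field_simps)
  moreover have "gauss_curvature ?g p = riemann ?g 1 2 1 2 p / lam p"
    using pos[OF S(2)] by (simp add: gauss_curvature_def sum_2 mat_def det_2)
  ultimately show ?thesis
    by (simp only: divide_divide_eq_left)
qed


section \<open>The shape metric in the chart\<close>

lemma mass_inner_simps:
  "mass_inner m (x + y) z = mass_inner m x z + mass_inner m y z"
  "mass_inner m (x - y) z = mass_inner m x z - mass_inner m y z"
  "mass_inner m (c *\<^sub>R x) z = c * mass_inner m x z"
  "mass_inner m z (x + y) = mass_inner m z x + mass_inner m z y"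
  "mass_inner m z (x - y) = mass_inner m z x - mass_inner m z y"
  "mass_inner m z (c *\<^sub>R x) = c * mass_inner m z x"
  by (simp_all add: mass_inner_def sum_3 algebra_simps)

lemma mass_inner_commute: "mass_inner m x y = mass_inner m y x"
  by (simp add: mass_inner_def inner_commute)

lemma inertia_eq_mass_inner: "inertia m x = mass_inner m x x"
  by (simp add: inertia_def mass_inner_def power2_norm_eq_inner)

lemma mass_inner_rot_field_self: "mass_inner m x (rot_field x) = 0"
  by (simp add: mass_inner_def rot_field_def inner_vec_def sum_2)

lemma mass_inner_rot_field_rot_field:
  "mass_inner m (rot_field x) (rot_field x) = mass_inner m x x"
  by (simp add: mass_inner_def rot_field_def inner_vec_def sum_2 add.commute)

lemma mass_sum_rot_field:
  assumes "(\<Sum>i\<in>UNIV. m $ i *\<^sub>R x $ i) = 0"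
  shows "(\<Sum>i\<in>UNIV. m $ i *\<^sub>R rot_field x $ i) = 0"
  using assms by (simp add: rot_field_def vec_eq_iff forall_2 sum_3)

text \<open>Translations are orthogonal to centred configurations, so centring one argument of a mass inner
  product is harmless when the other one is centred already.\<close>

lemma mass_inner_centered:
  assumes "(\<Sum>i\<in>UNIV. m $ i *\<^sub>R x $ i) = 0"
  shows "mass_inner m (centered m w) x = mass_inner m w x"
proof -
  define c where "c = (\<Sum>j\<in>UNIV. m $ j *\<^sub>R w $ j) /\<^sub>R (\<Sum>j\<in>UNIV. m $ j)"
  have "centered m w $ i = w $ i - c" for i by (simp add: centered_def c_def)
  then have "mass_inner m (centered m w) x = mass_inner m w x - c \<bullet> (\<Sum>i\<in>UNIV. m $ i *\<^sub>R x $ i)"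
    by (simp add: mass_inner_def sum_3 inner_diff_left inner_add_right inner_commute[of c])
      (simp add: algebra_simps inner_commute)
  then show ?thesis using assms by simp
qed

text \<open>The velocity of the triangle when the chart coordinate moves in direction \<open>i\<close>.\<close>

definition vertex_motion :: "2 \<Rightarrow> config" where
  "vertex_motion i = vector [0, 0, axis i 1]"

lemma vertex_motion_nth [simp]:
  "vertex_motion i $ 1 = 0" "vertex_motion i $ 2 = 0" "vertex_motion i $ 3 = axis i 1"
  by (simp_all add: vertex_motion_def)

lemma centered_triangle_add:
  "centered m (triangle (p + t *\<^sub>R axis i 1)) =
    centered m (triangle p) + t *\<^sub>R centered m (vertex_motion i)"
  by (simp add: centered_def vec_eq_iff forall_3 sum_3 algebra_simps)

lemma mass_inner_vertex_motion: "mass_inner m (vertex_motion i) x = m $ 3 * x $ 3 $ i"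
  by (simp add: mass_inner_def sum_3 inner_axis')

lemma power2_norm_vec_2: "(norm (v :: real^2))\<^sup>2 = (v $ 1)\<^sup>2 + (v $ 2)\<^sup>2"
  unfolding power2_norm_eq_inner by (simp add: inner_vec_def sum_2 power2_eq_square)

lemma mass_sum_pos: "m \<in> mass_octant \<Longrightarrow> m $ 1 + m $ 2 + m $ 3 > 0"
  by (simp add: mass_octant_def add_pos_pos)

text \<open>Lagrange's formula for the moment of inertia about the centre of mass in terms of the
  mutual distances.\<close>

lemma inertia_centered_triangle:
  assumes "m \<in> mass_octant"
  shows "inertia m (centered m (triangle p)) =
    (m $ 1 * m $ 2 + m $ 2 * m $ 3 * (norm (p - axis 1 1))\<^sup>2 + m $ 3 * m $ 1 * (norm p)\<^sup>2)
      / (m $ 1 + m $ 2 + m $ 3)"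
proof -
  define k where "k = inverse (m $ 1 + m $ 2 + m $ 3)"
  have k: "k * (m $ 1 + m $ 2 + m $ 3) = 1" using mass_sum_pos[OF assms] by (simp add: k_def)
  \<comment> \<open>Used once per coordinate: \<open>e\<close> is \<open>1\<close> or \<open>0\<close>, the coordinates of the second vertex.\<close>
  have "k * (a + b + c) = 1 \<Longrightarrow>
      a * (k * (b * e + c * x))\<^sup>2 + b * (e - k * (b * e + c * x))\<^sup>2 + c * (x - k * (b * e + c * x))\<^sup>2
      = k * (a * b * e\<^sup>2 + b * c * (x - e)\<^sup>2 + c * a * x\<^sup>2)" for a b c e x :: real
    by algebra
  note id = this[OF k]
  have neg: "(- x - y)\<^sup>2 = (x + y)\<^sup>2" for x y :: real by algebra
  have "inertia m (centered m (triangle p)) =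
      k * (m $ 1 * m $ 2 * 1\<^sup>2 + m $ 2 * m $ 3 * (p $ 1 - 1)\<^sup>2 + m $ 3 * m $ 1 * (p $ 1)\<^sup>2)
      + k * (m $ 1 * m $ 2 * 0\<^sup>2 + m $ 2 * m $ 3 * (p $ 2 - 0)\<^sup>2 + m $ 3 * m $ 1 * (p $ 2)\<^sup>2)"
    unfolding id[symmetric]
    by (simp add: inertia_def centered_def sum_3 power2_norm_vec_2 axis_def distrib_left neg flip: k_def)
  also have "\<dots> = k * (m $ 1 * m $ 2 + m $ 2 * m $ 3 * (norm (p - axis 1 1))\<^sup>2 + m $ 3 * m $ 1 * (norm p)\<^sup>2)"
    by (simp add: power2_norm_vec_2 axis_def algebra_simps)
  finally show ?thesis by (simp add: k_def divide_inverse mult.commute)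
qed

text \<open>The lift is \<open>y / |y|\<close> with \<open>y\<close> affine in the chart coordinate, so its derivative is the
  velocity \<open>b\<close> of \<open>y\<close> with the radial component removed, rescaled by \<open>1 / |y|\<close>.\<close>

lemma has_partial_lift:
  fixes m :: masses and p :: "real^2" and i :: 2
  assumes m: "m \<in> mass_octant"
  defines "y \<equiv> centered m (triangle p)" and "b \<equiv> centered m (vertex_motion i)"
  shows "has_partial (lift m) i
    ((1 / sqrt (inertia m y)) *\<^sub>R (b - (m $ 3 * y $ 3 $ i / inertia m y) *\<^sub>R y)) p"
proof -
  define F where "F = inertia m y"
  have F: "F > 0" unfolding F_def y_def by (rule inertia_centered_triangle_pos[OF m])
  define a where "a = m $ 3 * y $ 3 $ i"
  define c where "c = inertia m b"
  have "mass_inner m b y = a"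
    unfolding a_def b_def mass_inner_vertex_motion[symmetric]
    by (rule mass_inner_centered) (simp add: y_def mass_sum_centered[OF m])
  then have I: "inertia m (y + t *\<^sub>R b) = F + 2 * a * t + c * t\<^sup>2" for t
    using mass_inner_commute[of m y b]
    by (simp add: inertia_eq_mass_inner mass_inner_simps F_def c_def power2_eq_square algebra_simps)
  have eq: "lift m (p + t *\<^sub>R axis i 1) = (1 / sqrt (F + 2 * a * t + c * t\<^sup>2)) *\<^sub>R (y + t *\<^sub>R b)" for t
    by (simp add: lift_def Let_def centered_triangle_add I divide_inverse flip: y_def b_def)
  have "((\<lambda>t. 1 / sqrt (F + 2 * a * t + c * t\<^sup>2)) has_real_derivative - a / (F * sqrt F)) (at 0)"
    using F by (auto intro!: derivative_eq_intros simp: field_simps)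
  moreover have "((\<lambda>t. y + t *\<^sub>R b) has_vector_derivative b) (at 0)"
    by (auto intro!: derivative_eq_intros)
  ultimately have "((\<lambda>t. (1 / sqrt (F + 2 * a * t + c * t\<^sup>2)) *\<^sub>R (y + t *\<^sub>R b)) has_vector_derivative
      (1 / sqrt F) *\<^sub>R b + (- a / (F * sqrt F)) *\<^sub>R y) (at 0)"
    using has_vector_derivative_scaleR by fastforce
  then show ?thesis
    unfolding has_partial_def eq F_def[symmetric] a_def[symmetric]
    by (simp add: scaleR_diff_right mult.commute)
qed

text \<open>Both the radial component (by normalisation) and the component along the rotation (by
  horizontality) of a coordinate velocity are removed.  These two components are proportional to
  the coordinates of the third vertex \<open>v\<close> of \<open>y\<close> and of \<open>v\<close> turned by a right angle; as the two are
  orthogonal and of equal length, removing both keeps the metric a multiple of the Euclidean one.\<close>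

lemma shape_metric_eq:
  assumes m: "m \<in> mass_octant"
  shows "shape_metric m p = (m $ 1 * m $ 2 * m $ 3 / (m $ 1 + m $ 2 + m $ 3)
    / (inertia m (centered m (triangle p)))\<^sup>2) *\<^sub>R mat 1"
proof -
  define y where "y = centered m (triangle p)"
  define F where "F = inertia m y"
  have F: "F > 0" unfolding F_def y_def by (rule inertia_centered_triangle_pos[OF m])
  define M where "M = m $ 1 + m $ 2 + m $ 3"
  have M: "M > 0" unfolding M_def by (rule mass_sum_pos[OF m])
  define b where "b i = centered m (vertex_motion i)" for i
  have y0: "(\<Sum>i\<in>UNIV. m $ i *\<^sub>R y $ i) = 0" by (simp only: y_def mass_sum_centered[OF m])
  have b0: "(\<Sum>j\<in>UNIV. m $ j *\<^sub>R b i $ j) = 0" for i by (simp only: b_def mass_sum_centered[OF m])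
  have b_y: "mass_inner m (b i) y = m $ 3 * y $ 3 $ i" for i
    by (simp only: b_def mass_inner_centered[OF y0] mass_inner_vertex_motion)
  have bJ: "mass_inner m (b i) (rot_field y) = m $ 3 * quarter_turn (y $ 3) $ i" for i
    by (simp only: b_def mass_inner_centered[OF mass_sum_rot_field[OF y0]] mass_inner_vertex_motion)
      (simp add: rot_field_def)
  have bb: "mass_inner m (b i) (b j) = (if i = j then m $ 3 * (m $ 1 + m $ 2) / M else 0)" for i j
  proof -
    have "mass_inner m (b i) (b j) = m $ 3 * b j $ 3 $ i"
      using mass_inner_centered[OF b0] by (simp add: b_def mass_inner_vertex_motion)
    also have "b j $ 3 = axis j 1 - (m $ 3 / M) *\<^sub>R axis j 1"
      by (simp add: b_def centered_def sum_3 M_def divide_inverse mult.commute)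
    finally show ?thesis using M by (cases "i = j") (simp_all add: axis_def M_def field_simps)
  qed
  have yy: "mass_inner m y y = F" by (simp add: F_def inertia_eq_mass_inner)
  have x: "lift m p = (1 / sqrt F) *\<^sub>R y"
    by (simp add: lift_def Let_def F_def divide_inverse flip: y_def)
  have rx: "rot_field (lift m p) = (1 / sqrt F) *\<^sub>R rot_field y"
    by (simp add: x rot_field_def vec_eq_iff forall_2)
  have hor: "horizontal m (lift m p) (partial i (lift m) p) = (1 / sqrt F) *\<^sub>R
      (b i - (m $ 3 * y $ 3 $ i / F) *\<^sub>R y - (m $ 3 * quarter_turn (y $ 3) $ i / F) *\<^sub>R rot_field y)" for i
    unfolding horizontal_def partial_eqI[OF has_partial_lift[OF m]] rx
      y_def[symmetric] F_def[symmetric] b_def[symmetric]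
    using F by (simp add: mass_inner_simps mass_inner_rot_field_self mass_inner_rot_field_rot_field
        yy bJ algebra_simps flip: power2_eq_square)
  have J: "y $ 3 $ i * y $ 3 $ j + quarter_turn (y $ 3) $ i * quarter_turn (y $ 3) $ j
      = (if i = j then (norm (y $ 3))\<^sup>2 else 0)" for i j
  proof -
    have "\<forall>i j. y $ 3 $ i * y $ 3 $ j + quarter_turn (y $ 3) $ i * quarter_turn (y $ 3) $ j
      = (if i = j then (norm (y $ 3))\<^sup>2 else 0)"
      by (simp add: forall_2 power2_norm_eq_inner inner_vec_def sum_2)
    then show ?thesis by blast
  qed
  \<comment> \<open>The Gram determinant, for the Hermitian mass product, of \<open>y\<close> and the velocity of \<open>y\<close>.  It is
    independent of \<open>p\<close>, since \<open>y\<close> is affine in \<open>p\<close> with that velocity as complex slope.\<close>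
  have area: "m $ 3 * (m $ 1 + m $ 2) / M * F - (m $ 3)\<^sup>2 * (norm (y $ 3))\<^sup>2
      = m $ 1 * m $ 2 * m $ 3 / M"
  proof -
    have "y $ 3 $ 1 = ((m $ 1 + m $ 2) * p $ 1 - m $ 2) / M" "y $ 3 $ 2 = ((m $ 1 + m $ 2) * p $ 2) / M"
    proof -
      have "y $ 3 $ 1 = p $ 1 - (m $ 2 + m $ 3 * p $ 1) / M" "y $ 3 $ 2 = p $ 2 - m $ 3 * p $ 2 / M"
        by (simp_all add: y_def centered_def sum_3 axis_def divide_inverse mult.commute flip: M_def)
      then show "y $ 3 $ 1 = ((m $ 1 + m $ 2) * p $ 1 - m $ 2) / M" "y $ 3 $ 2 = ((m $ 1 + m $ 2) * p $ 2) / M"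
        using M by (simp_all add: M_def field_simps)
    qed
    then have N: "(norm (y $ 3))\<^sup>2 = (((m $ 1 + m $ 2) * p $ 1 - m $ 2)\<^sup>2 + ((m $ 1 + m $ 2) * p $ 2)\<^sup>2) / M\<^sup>2"
      unfolding power2_norm_vec_2 by (simp add: power_divide add_divide_distrib)
    have F_eq: "F = (m $ 1 * m $ 2 + m $ 2 * m $ 3 * ((p $ 1 - 1)\<^sup>2 + (p $ 2)\<^sup>2)
        + m $ 3 * m $ 1 * ((p $ 1)\<^sup>2 + (p $ 2)\<^sup>2)) / M"
      unfolding F_def y_def inertia_centered_triangle[OF m] M_def power2_norm_vec_2
      by (simp add: axis_def)
    have frac: "m $ 3 * (m $ 1 + m $ 2) / M * (Q / M) - (m $ 3)\<^sup>2 * (R / M\<^sup>2)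
        = (m $ 3 * (m $ 1 + m $ 2) * Q - (m $ 3)\<^sup>2 * R) / M\<^sup>2" for Q R
      by (simp add: power2_eq_square diff_divide_distrib)
    have poly: "c * (a + b) * (a * b + b * c * ((x - 1)\<^sup>2 + z\<^sup>2) + c * a * (x\<^sup>2 + z\<^sup>2))
      - c\<^sup>2 * (((a + b) * x - b)\<^sup>2 + ((a + b) * z)\<^sup>2) = a * b * c * (a + b + c)" for a b c x z :: real
      by algebra
    have "m $ 3 * (m $ 1 + m $ 2) / M * F - (m $ 3)\<^sup>2 * (norm (y $ 3))\<^sup>2
        = m $ 1 * m $ 2 * m $ 3 * M / M\<^sup>2"
      unfolding N F_eq frac
      by (rule arg_cong[where f = "\<lambda>x. x / M\<^sup>2"]) (unfold M_def, rule poly)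
    also have "\<dots> = m $ 1 * m $ 2 * m $ 3 / M" using M by (simp add: power2_eq_square)
    finally show ?thesis .
  qed
  have "mass_inner m (horizontal m (lift m p) (partial i (lift m) p))
      (horizontal m (lift m p) (partial j (lift m) p))
    = (mass_inner m (b i) (b j) - (m $ 3)\<^sup>2 * (y $ 3 $ i * y $ 3 $ j
        + quarter_turn (y $ 3) $ i * quarter_turn (y $ 3) $ j) / F) / F" for i j
  proof -
    have swap: "mass_inner m y (b j) = m $ 3 * y $ 3 $ j"
      "mass_inner m (rot_field y) (b j) = m $ 3 * quarter_turn (y $ 3) $ j"
      "mass_inner m (rot_field y) y = 0"
      using b_y[of j] bJ[of j] mass_inner_rot_field_self[of m y]
      by (simp_all only: mass_inner_commute[of m y "b j"] mass_inner_commute[of m "rot_field y" "b j"]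
          mass_inner_commute[of m "rot_field y" y])
    show ?thesis
      unfolding hor mass_inner_simps mass_inner_rot_field_self mass_inner_rot_field_rot_field
        yy b_y bJ swap
      using F by (simp add: field_simps power2_eq_square)
  qed
  then have "mass_inner m (horizontal m (lift m p) (partial i (lift m) p))
      (horizontal m (lift m p) (partial j (lift m) p))
    = (if i = j then (m $ 3 * (m $ 1 + m $ 2) / M * F - (m $ 3)\<^sup>2 * (norm (y $ 3))\<^sup>2) / F\<^sup>2 else 0)" for i j
    unfolding J bb using F by (simp add: diff_divide_distrib power2_eq_square)
  then show ?thesis
    unfolding area by (simp add: shape_metric_def vec_eq_iff mat_def F_def M_def y_def)
qed

section \<open>The Jacobi-Maupertuis metric in the chart\<close>

text \<open>With the pairwise mass products as coefficients these are the moment of inertia (times the total mass) and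
  the potential of the triangle with vertices \<open>0\<close>, \<open>(1, 0)\<close>, \<open>p\<close>; they are the \<open>G\<close> and \<open>V\<close> of the introduction.
  The constant \<open>A\<close> belongs to the side of length \<open>1\<close>.\<close>

definition linear_sides :: "real \<Rightarrow> real \<Rightarrow> real \<Rightarrow> real^2 \<Rightarrow> real" where
  "linear_sides A B C p = A + B * (norm (p - axis 1 1))\<^sup>2 + C * (norm p)\<^sup>2"

definition inverse_sides :: "real \<Rightarrow> real \<Rightarrow> real \<Rightarrow> real^2 \<Rightarrow> real" where
  "inverse_sides A B C p = A + B / (norm (p - axis 1 1))\<^sup>2 + C / (norm p)\<^sup>2"

text \<open>The potential is homogeneous of degree \<open>-2\<close>, so normalising the moment of inertia multiplies it
  by that moment.\<close>

lemma potential_lift: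
  assumes m: "m \<in> mass_octant"
  shows "potential m (lift m p) = inertia m (centered m (triangle p))
    * inverse_sides (m $ 1 * m $ 2) (m $ 2 * m $ 3) (m $ 3 * m $ 1) p"
proof -
  define F where "F = inertia m (centered m (triangle p))"
  have F: "F > 0" unfolding F_def by (rule inertia_centered_triangle_pos[OF m])
  have "lift m p $ i - lift m p $ j = (1 / sqrt F) *\<^sub>R (triangle p $ i - triangle p $ j)" for i j
    by (simp add: lift_def Let_def F_def centered_diff divide_inverse flip: scaleR_diff_right)
  then have d: "(dist (lift m p $ i) (lift m p $ j))\<^sup>2 = (dist (triangle p $ i) (triangle p $ j))\<^sup>2 / F" for i j
    using F by (simp add: dist_norm power_divide)
  show ?thesis
    unfolding potential_def d F_def[symmetric] inverse_sides_def
    by (simp add: dist_norm norm_minus_commute[of "axis 1 1"] norm_axis_1 algebra_simps)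
qed

lemma jacobi_metric_eq:
  assumes m: "m \<in> mass_octant"
  defines "A \<equiv> m $ 1 * m $ 2" and "B \<equiv> m $ 2 * m $ 3" and "C \<equiv> m $ 3 * m $ 1"
  shows "jacobi_metric m p =
    (m $ 1 * m $ 2 * m $ 3 * (inverse_sides A B C p / linear_sides A B C p)) *\<^sub>R mat 1"
proof -
  define F where "F = inertia m (centered m (triangle p))"
  have F: "F > 0" unfolding F_def by (rule inertia_centered_triangle_pos[OF m])
  have M: "m $ 1 + m $ 2 + m $ 3 > 0" by (rule mass_sum_pos[OF m])
  have "linear_sides A B C p = (m $ 1 + m $ 2 + m $ 3) * F"
    using M by (simp add: F_def inertia_centered_triangle[OF m] linear_sides_def A_def B_def C_def)
  moreover have "F * v * (k / M / F\<^sup>2) = k * (v / (M * F))" for v k M :: real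
    using F by (simp add: field_simps power2_eq_square)
  ultimately show ?thesis
    by (simp only: jacobi_metric_def potential_lift[OF m] shape_metric_eq[OF m] scaleR_scaleR
        flip: F_def A_def B_def C_def)
qed

lemma has_partial_square_norm:
  "((\<lambda>t. (norm (p + t *\<^sub>R axis i 1 - a))\<^sup>2) has_real_derivative 2 * (p - a) $ i) (at 0)"
proof -
  have "(norm (p + t *\<^sub>R axis i 1 - a))\<^sup>2 = (norm (p - a))\<^sup>2 + 2 * t * (p - a) $ i + t\<^sup>2" for t
    unfolding power2_norm_eq_inner
    by (simp add: algebra_simps inner_axis inner_axis' inner_axis_axis inner_commute power2_eq_square)
  then show ?thesis by (auto intro!: derivative_eq_intros)
qed

lemma has_partial_coordinate:
  "((\<lambda>t. (p + t *\<^sub>R axis i 1 - a) $ i) has_real_derivative 1) (at 0)"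
  by (auto intro!: derivative_eq_intros simp: axis_def)

lemma has_partial_inverse_square_norm:
  assumes "p \<noteq> a"
  shows "((\<lambda>t. B / (norm (p + t *\<^sub>R axis i 1 - a))\<^sup>2) has_real_derivative
      - 2 * (B * (p - a) $ i / ((norm (p - a))\<^sup>2)\<^sup>2)) (at 0)"
proof -
  have "((\<lambda>t. B / (norm (p + t *\<^sub>R axis i 1 - a))\<^sup>2) has_real_derivative
      (0 * (norm (p + 0 *\<^sub>R axis i 1 - a))\<^sup>2 - B * (2 * (p - a) $ i))
        / ((norm (p + 0 *\<^sub>R axis i 1 - a))\<^sup>2 * (norm (p + 0 *\<^sub>R axis i 1 - a))\<^sup>2)) (at 0)"
    by (rule DERIV_divide[OF DERIV_const has_partial_square_norm]) (use assms in simp)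
  moreover have "(0 * S - B * (2 * x)) / (S * S) = - 2 * (B * x / S\<^sup>2)" for S x :: real
    by (simp add: power2_eq_square)
  ultimately show ?thesis by (simp only: scaleR_zero_left add_0_right)
qed

lemma has_partial_coordinate_over_norm_4:
  assumes "p \<noteq> a"
  shows "((\<lambda>t. B * (p + t *\<^sub>R axis i 1 - a) $ i / ((norm (p + t *\<^sub>R axis i 1 - a))\<^sup>2)\<^sup>2) has_real_derivative
      B / ((norm (p - a))\<^sup>2)\<^sup>2 - 4 * (B * ((p - a) $ i)\<^sup>2 / ((norm (p - a))\<^sup>2) ^ 3)) (at 0)"
proof -
  define x where "x = (p - a) $ i"
  define s where "s = (norm (p - a))\<^sup>2"
  have s: "s > 0" using assms by (simp add: s_def)
  have "((\<lambda>t. B * (p + t *\<^sub>R axis i 1 - a) $ i / ((norm (p + t *\<^sub>R axis i 1 - a))\<^sup>2)\<^sup>2) has_real_derivative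
      (B * 1 * ((norm (p + 0 *\<^sub>R axis i 1 - a))\<^sup>2)\<^sup>2
        - B * (p + 0 *\<^sub>R axis i 1 - a) $ i * (of_nat 2 * (2 * (p - a) $ i
            * ((norm (p + 0 *\<^sub>R axis i 1 - a))\<^sup>2) ^ (2 - Suc 0))))
        / (((norm (p + 0 *\<^sub>R axis i 1 - a))\<^sup>2)\<^sup>2 * ((norm (p + 0 *\<^sub>R axis i 1 - a))\<^sup>2)\<^sup>2)) (at 0)"
    by (rule DERIV_divide[OF DERIV_cmult[OF has_partial_coordinate] DERIV_power[OF has_partial_square_norm]])
      (use assms in simp)
  also have "(B * 1 * ((norm (p + 0 *\<^sub>R axis i 1 - a))\<^sup>2)\<^sup>2
        - B * (p + 0 *\<^sub>R axis i 1 - a) $ i * (of_nat 2 * (2 * (p - a) $ i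
            * ((norm (p + 0 *\<^sub>R axis i 1 - a))\<^sup>2) ^ (2 - Suc 0))))
        / (((norm (p + 0 *\<^sub>R axis i 1 - a))\<^sup>2)\<^sup>2 * ((norm (p + 0 *\<^sub>R axis i 1 - a))\<^sup>2)\<^sup>2)
      = (B * s\<^sup>2 - B * x * (2 * (2 * x * s))) / (s\<^sup>2 * s\<^sup>2)"
    by (simp only: s_def x_def scaleR_zero_left add_0_right mult_1_right) simp
  also have "\<dots> = B / s\<^sup>2 - 4 * (B * x\<^sup>2 / s ^ 3)"
    using s by (simp add: field_simps power2_eq_square power3_eq_cube)
  finally show ?thesis by (simp only: s_def x_def)
qed

text \<open>For both functions only the combination \<open>f \<Delta>f - |\<nabla>f|\<^sup>2\<close> enters the Laplacian of the logarithm.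
  It simplifies to a function of the side lengths because the gradients of \<open>s\<close> and \<open>t\<close> are twice the
  sides of the triangle that meet at \<open>p\<close>, for which \<open>2 (p - (1, 0)) \<bullet> p = s + t - 1\<close>.\<close>

definition linear_sides_D :: "real \<Rightarrow> real \<Rightarrow> 2 \<Rightarrow> real^2 \<Rightarrow> real" where
  "linear_sides_D B C i p = 2 * (B * (p - axis 1 1) $ i + C * p $ i)"

lemma linear_sides_partials:
  shows "has_partial (linear_sides A B C) i (linear_sides_D B C i p) p"
    and "has_partial (linear_sides_D B C i) i (2 * (B + C)) p"
    and "linear_sides A B C p * (2 * (B + C) + 2 * (B + C))
        - ((linear_sides_D B C 1 p)\<^sup>2 + (linear_sides_D B C 2 p)\<^sup>2)
      = 4 * (A * B + B * C + C * A)"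
proof -
  note d = has_partial_square_norm[of p i "axis 1 1"] has_partial_square_norm[of p i 0, unfolded diff_zero]
  show "has_partial (linear_sides A B C) i (linear_sides_D B C i p) p"
    unfolding has_partial_def linear_sides_def linear_sides_D_def
      has_real_derivative_iff_has_vector_derivative[symmetric]
    by (rule d derivative_eq_intros refl | simp add: algebra_simps)+
  show "has_partial (linear_sides_D B C i) i (2 * (B + C)) p"
    unfolding has_partial_def linear_sides_D_def
      has_real_derivative_iff_has_vector_derivative[symmetric]
    by (auto intro!: derivative_eq_intros simp: axis_def)
  show "linear_sides A B C p * (2 * (B + C) + 2 * (B + C))
        - ((linear_sides_D B C 1 p)\<^sup>2 + (linear_sides_D B C 2 p)\<^sup>2)
      = 4 * (A * B + B * C + C * A)"
    unfolding linear_sides_def linear_sides_D_def power2_norm_vec_2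
    by (simp add: axis_def power2_eq_square algebra_simps)
qed

definition inverse_sides_D :: "real \<Rightarrow> real \<Rightarrow> 2 \<Rightarrow> real^2 \<Rightarrow> real" where
  "inverse_sides_D B C i p =
    - 2 * (B * (p - axis 1 1) $ i / ((norm (p - axis 1 1))\<^sup>2)\<^sup>2 + C * p $ i / ((norm p)\<^sup>2)\<^sup>2)"

text \<open>The pure second derivative in direction \<open>i\<close>.\<close>

definition inverse_sides_D2 :: "real \<Rightarrow> real \<Rightarrow> 2 \<Rightarrow> real^2 \<Rightarrow> real" where
  "inverse_sides_D2 B C i p =
    - 2 * (B / ((norm (p - axis 1 1))\<^sup>2)\<^sup>2 + C / ((norm p)\<^sup>2)\<^sup>2)
    + 8 * (B * ((p - axis 1 1) $ i)\<^sup>2 / ((norm (p - axis 1 1))\<^sup>2) ^ 3 + C * (p $ i)\<^sup>2 / ((norm p)\<^sup>2) ^ 3)"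

lemma inverse_sides_partials:
  assumes p: "p \<in> chart_domain"
  shows "has_partial (inverse_sides A B C) i (inverse_sides_D B C i p) p"
    and "has_partial (inverse_sides_D B C i) i (inverse_sides_D2 B C i p) p"
    and "inverse_sides A B C p * (inverse_sides_D2 B C 1 p + inverse_sides_D2 B C 2 p)
        - ((inverse_sides_D B C 1 p)\<^sup>2 + (inverse_sides_D B C 2 p)\<^sup>2)
      = 4 * (A * B / ((norm (p - axis 1 1))\<^sup>2)\<^sup>2 + C * A / ((norm p)\<^sup>2)\<^sup>2
          + B * C / (((norm (p - axis 1 1))\<^sup>2)\<^sup>2 * ((norm p)\<^sup>2)\<^sup>2))"
proof -
  have nz: "norm (p - axis 1 1) \<noteq> 0" "norm p \<noteq> 0" "p \<noteq> axis 1 1" "p \<noteq> 0"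
    using p by (auto simp: chart_domain_def)
  have "((\<lambda>t. A + B / (norm (p + t *\<^sub>R axis i 1 - axis 1 1))\<^sup>2 + C / (norm (p + t *\<^sub>R axis i 1 - 0))\<^sup>2)
      has_real_derivative 0 + - 2 * (B * (p - axis 1 1) $ i / ((norm (p - axis 1 1))\<^sup>2)\<^sup>2)
        + - 2 * (C * (p - 0) $ i / ((norm (p - 0))\<^sup>2)\<^sup>2)) (at 0)"
    by (intro DERIV_add DERIV_const has_partial_inverse_square_norm nz)
  then show "has_partial (inverse_sides A B C) i (inverse_sides_D B C i p) p"
    unfolding has_partial_def inverse_sides_def inverse_sides_D_def
      has_real_derivative_iff_has_vector_derivative[symmetric]
    by (simp only: diff_zero add_0 distrib_left)
  have "((\<lambda>t. - 2 * (B * (p + t *\<^sub>R axis i 1 - axis 1 1) $ i / ((norm (p + t *\<^sub>R axis i 1 - axis 1 1))\<^sup>2)\<^sup>2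
      + C * (p + t *\<^sub>R axis i 1 - 0) $ i / ((norm (p + t *\<^sub>R axis i 1 - 0))\<^sup>2)\<^sup>2)) has_real_derivative
      - 2 * (B / ((norm (p - axis 1 1))\<^sup>2)\<^sup>2 - 4 * (B * ((p - axis 1 1) $ i)\<^sup>2 / ((norm (p - axis 1 1))\<^sup>2) ^ 3)
        + (C / ((norm (p - 0))\<^sup>2)\<^sup>2 - 4 * (C * ((p - 0) $ i)\<^sup>2 / ((norm (p - 0))\<^sup>2) ^ 3)))) (at 0)"
    by (intro DERIV_add DERIV_cmult has_partial_coordinate_over_norm_4 nz)
  then show "has_partial (inverse_sides_D B C i) i (inverse_sides_D2 B C i p) p"
    unfolding has_partial_def inverse_sides_D_def inverse_sides_D2_def
      has_real_derivative_iff_has_vector_derivative[symmetric]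
    by (simp only: diff_zero) (simp add: algebra_simps)
  have coords: "(p - axis 1 1) $ 1 = p $ 1 - 1" "(p - axis 1 1) $ 2 = p $ 2"
    by (simp_all add: axis_def)
  \<comment> \<open>With the reciprocals as variables subject to two relations, the identity is polynomial.\<close>
  define r where "r = inverse ((norm (p - axis 1 1))\<^sup>2)"
  define q where "q = inverse ((norm p)\<^sup>2)"
  have "((p $ 1 - 1)\<^sup>2 + (p $ 2)\<^sup>2) * r = 1" "((p $ 1)\<^sup>2 + (p $ 2)\<^sup>2) * q = 1"
  proof -
    have "(norm (p - axis 1 1))\<^sup>2 * r = 1" "(norm p)\<^sup>2 * q = 1" using nz by (simp_all add: r_def q_def)
    then show "((p $ 1 - 1)\<^sup>2 + (p $ 2)\<^sup>2) * r = 1" "((p $ 1)\<^sup>2 + (p $ 2)\<^sup>2) * q = 1"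
      unfolding power2_norm_vec_2 by (simp_all add: axis_def)
  qed
  then have "(A + B * r + C * q) * (
      (- 2 * (B * r\<^sup>2 + C * q\<^sup>2) + 8 * (B * (p $ 1 - 1)\<^sup>2 * r ^ 3 + C * (p $ 1)\<^sup>2 * q ^ 3))
    + (- 2 * (B * r\<^sup>2 + C * q\<^sup>2) + 8 * (B * (p $ 2)\<^sup>2 * r ^ 3 + C * (p $ 2)\<^sup>2 * q ^ 3)))
    - ((- 2 * (B * (p $ 1 - 1) * r\<^sup>2 + C * p $ 1 * q\<^sup>2))\<^sup>2 + (- 2 * (B * p $ 2 * r\<^sup>2 + C * p $ 2 * q\<^sup>2))\<^sup>2)
    = 4 * (A * B * r\<^sup>2 + C * A * q\<^sup>2 + B * C * (r\<^sup>2 * q\<^sup>2))"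
    by algebra
  then show "inverse_sides A B C p * (inverse_sides_D2 B C 1 p + inverse_sides_D2 B C 2 p)
        - ((inverse_sides_D B C 1 p)\<^sup>2 + (inverse_sides_D B C 2 p)\<^sup>2)
      = 4 * (A * B / ((norm (p - axis 1 1))\<^sup>2)\<^sup>2 + C * A / ((norm p)\<^sup>2)\<^sup>2
          + B * C / (((norm (p - axis 1 1))\<^sup>2)\<^sup>2 * ((norm p)\<^sup>2)\<^sup>2))"
    unfolding inverse_sides_def inverse_sides_D2_def inverse_sides_D_def divide_inverse inverse_mult_distrib
      power_inverse[of "(norm (p - axis 1 1))\<^sup>2", symmetric] power_inverse[of "(norm p)\<^sup>2", symmetric]
      r_def[symmetric] q_def[symmetric] coords .
qed

lemma open_chart_domain: "open chart_domain"
  unfolding chart_domain_def by (intro open_Diff finite_imp_closed) auto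

text \<open>The function \<open>\<sigma> V\<^sup>2 - \<tau> G\<^sup>2\<close> of the introduction, in terms of the two squared sides.\<close>

definition curvature_numerator :: "real \<Rightarrow> real \<Rightarrow> real \<Rightarrow> real \<Rightarrow> real \<Rightarrow> real" where
  "curvature_numerator A B C s t =
     (A * B + B * C + C * A) * (A + B / s + C / t)\<^sup>2
     - (A * B / s\<^sup>2 + C * A / t\<^sup>2 + B * C / (s\<^sup>2 * t\<^sup>2)) * (A + B * s + C * t)\<^sup>2"

lemma gauss_curvature_sides_metric:
  fixes A B C k :: real and p :: "real^2"
  defines "V \<equiv> inverse_sides A B C" and "G \<equiv> linear_sides A B C"
  assumes pos: "A > 0" "B > 0" "C > 0" "k > 0" and p: "p \<in> chart_domain"
  shows "gauss_curvature (\<lambda>q. (k * (V q / G q)) *\<^sub>R mat 1) p =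
    2 * curvature_numerator A B C ((norm (p - axis 1 1))\<^sup>2) ((norm p)\<^sup>2) / (k * (V p ^ 3 * G p))"
proof -
  define DG where "DG = linear_sides_D B C"
  define DV where "DV = inverse_sides_D B C"
  define H where "H = inverse_sides_D2 B C"
  note dG = linear_sides_partials(1)[of A B C, folded G_def DG_def]
    linear_sides_partials(2)[where B = B and C = C, folded DG_def]
    linear_sides_partials(3)[of A B C, folded G_def DG_def]
  note dV = inverse_sides_partials(1)[where A = A and B = B and C = C, folded V_def DV_def]
    inverse_sides_partials(2)[where B = B and C = C, folded DV_def H_def]
    inverse_sides_partials(3)[OF p, of A B C, folded V_def DV_def H_def]
  have V: "V q > 0" and G: "G q > 0" for q
    using pos by (auto simp: V_def G_def inverse_sides_def linear_sides_def intro!: add_pos_nonneg)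
  \<comment> \<open>The first and second logarithmic derivatives of \<open>V / G\<close>.\<close>
  define \<phi> where "\<phi> = (\<lambda>i q. DV i q / V q - DG i q / G q)"
  define \<psi> where "\<psi> i = (H i p * V p - (DV i p)\<^sup>2) / (V p)\<^sup>2 - (2 * (B + C) * G p - (DG i p)\<^sup>2) / (G p)\<^sup>2" for i
  have d1: "has_partial (\<lambda>q. k * (V q / G q)) i (k * (V q / G q) * \<phi> i q) q" if "q \<in> chart_domain" for i q
  proof -
    have "((\<lambda>t. k * (V (q + t *\<^sub>R axis i 1) / G (q + t *\<^sub>R axis i 1))) has_real_derivative
        k * ((DV i q * G (q + 0 *\<^sub>R axis i 1) - V (q + 0 *\<^sub>R axis i 1) * DG i q)
          / (G (q + 0 *\<^sub>R axis i 1) * G (q + 0 *\<^sub>R axis i 1)))) (at 0)"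
      using dV(1)[OF that, of i] dG(1)[of i q] G[of q]
      unfolding has_partial_def
      has_real_derivative_iff_has_vector_derivative[symmetric]
      by (intro DERIV_cmult DERIV_divide) auto
    moreover have "k * ((dv * g - v * dg) / (g * g)) = k * (v / g) * (dv / v - dg / g)"
      if "v > 0" "g > 0" for v g dv dg :: real
      using that by (simp add: field_simps)
    ultimately show ?thesis
      using V[of q] G[of q]
      unfolding has_partial_def has_real_derivative_iff_has_vector_derivative[symmetric] \<phi>_def by simp
  qed
  have d2: "has_partial (\<phi> i) i (\<psi> i) p" for i
  proof -
    have "((\<lambda>t. DV i (p + t *\<^sub>R axis i 1) / V (p + t *\<^sub>R axis i 1)
          - DG i (p + t *\<^sub>R axis i 1) / G (p + t *\<^sub>R axis i 1)) has_real_derivative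
        (H i p * V (p + 0 *\<^sub>R axis i 1) - DV i (p + 0 *\<^sub>R axis i 1) * DV i p)
          / (V (p + 0 *\<^sub>R axis i 1) * V (p + 0 *\<^sub>R axis i 1))
        - (2 * (B + C) * G (p + 0 *\<^sub>R axis i 1) - DG i (p + 0 *\<^sub>R axis i 1) * DG i p)
          / (G (p + 0 *\<^sub>R axis i 1) * G (p + 0 *\<^sub>R axis i 1))) (at 0)"
      using dV(1,2)[OF p, of i] dG(1,2)[of i p] V[of p] G[of p]
      unfolding has_partial_def
      has_real_derivative_iff_has_vector_derivative[symmetric]
      by (intro DERIV_diff DERIV_divide) auto
    then show ?thesis
      unfolding has_partial_def has_real_derivative_iff_has_vector_derivative[symmetric] \<phi>_def \<psi>_def
      by (simp add: power2_eq_square)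
  qed
  have "gauss_curvature (\<lambda>q. (k * (V q / G q)) *\<^sub>R mat 1) p = - (\<psi> 1 + \<psi> 2) / (2 * (k * (V p / G p)))"
    by (rule gauss_curvature_conformal[OF open_chart_domain p _ d1 d2]) (use V G pos in auto)
  also have "\<psi> 1 + \<psi> 2 = (V p * (H 1 p + H 2 p) - ((DV 1 p)\<^sup>2 + (DV 2 p)\<^sup>2)) / (V p)\<^sup>2
      - (G p * (2 * (B + C) + 2 * (B + C)) - ((DG 1 p)\<^sup>2 + (DG 2 p)\<^sup>2)) / (G p)\<^sup>2"
  proof -
    have "(a\<^sub>1 * v - b\<^sub>1) / w - (c * g - e\<^sub>1) / z + ((a\<^sub>2 * v - b\<^sub>2) / w - (c * g - e\<^sub>2) / z)
        = (v * (a\<^sub>1 + a\<^sub>2) - (b\<^sub>1 + b\<^sub>2)) / w - (g * (c + c) - (e\<^sub>1 + e\<^sub>2)) / z"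
      for a\<^sub>1 a\<^sub>2 b\<^sub>1 b\<^sub>2 c e\<^sub>1 e\<^sub>2 g v w z :: real
      by (simp add: add_divide_distrib diff_divide_distrib algebra_simps)
    then show ?thesis unfolding \<psi>_def .
  qed
  also note dV(3)
  also note dG(3)
  finally have *: "gauss_curvature (\<lambda>q. (k * (V q / G q)) *\<^sub>R mat 1) p =
      - (4 * (A * B / ((norm (p - axis 1 1))\<^sup>2)\<^sup>2 + C * A / ((norm p)\<^sup>2)\<^sup>2
      + B * C / (((norm (p - axis 1 1))\<^sup>2)\<^sup>2 * ((norm p)\<^sup>2)\<^sup>2)) / (V p)\<^sup>2
      - 4 * (A * B + B * C + C * A) / (G p)\<^sup>2) / (2 * (k * (V p / G p)))" .
  have "- (4 * \<tau> / v\<^sup>2 - 4 * \<sigma> / g\<^sup>2) / (2 * (k * (v / g))) = 2 * (\<sigma> * v\<^sup>2 - \<tau> * g\<^sup>2) / (k * (v ^ 3 * g))"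
    if "v > 0" "g > 0" for \<tau> \<sigma> v g :: real
    using that pos by (simp add: field_simps power2_eq_square power3_eq_cube)
  from this[OF V G] show ?thesis
    unfolding * curvature_numerator_def by (simp only: V_def G_def inverse_sides_def linear_sides_def)
qed

section \<open>The sign of the curvature near an equilateral triangle\<close>

lemma curvature_numerator_lagrange: "curvature_numerator A B C 1 1 = 0"
  by (simp add: curvature_numerator_def algebra_simps)

text \<open>The arguments are the squared sides along a path through the equilateral triangle on which \<open>t\<close>
  is stationary, whence only the partial derivative in \<open>s\<close> contributes, with weight \<open>2 y\<close>.\<close>

lemma curvature_numerator_derivative:
  "((\<lambda>x. curvature_numerator A B C (1 + 2 * y * x + x\<^sup>2) (1 + x\<^sup>2)) has_real_derivative
      4 * y * (A + B + C) * B * (A\<^sup>2 + C\<^sup>2 - B * (A + C))) (at 0)"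
  unfolding curvature_numerator_def
  by (rule derivative_eq_intros refl | (simp; fail))+ (simp add: power2_eq_square algebra_simps)

lemma sign_change_at_simple_zero:
  fixes h :: "real \<Rightarrow> real"
  assumes h: "(h has_real_derivative l) (at 0)" "h 0 = 0" "l \<noteq> 0" and "\<epsilon> > 0"
  shows "\<exists>x. \<bar>x\<bar> < \<epsilon> \<and> h x > 0" "\<exists>x. \<bar>x\<bar> < \<epsilon> \<and> h x < 0"
proof -
  have pos: "(\<exists>x. \<bar>x\<bar> < \<epsilon> \<and> h x > 0) \<and> (\<exists>x. \<bar>x\<bar> < \<epsilon> \<and> h x < 0)"
    if deriv: "(h has_real_derivative l) (at 0)" and zero: "h 0 = 0" and "l > 0" for h :: "real \<Rightarrow> real" and l
  proof -
    obtain d where d: "d > 0" "\<And>x. x > 0 \<Longrightarrow> x < d \<Longrightarrow> h x > 0"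
      using DERIV_pos_inc_right[OF deriv \<open>l > 0\<close>] zero by auto
    obtain e where e: "e > 0" "\<And>x. x > 0 \<Longrightarrow> x < e \<Longrightarrow> h (- x) < 0"
      using DERIV_pos_inc_left[OF deriv \<open>l > 0\<close>] zero by auto
    have "h (min d \<epsilon> / 2) > 0" "h (- (min e \<epsilon> / 2)) < 0"
      using d(1) e(1) \<open>\<epsilon> > 0\<close> by (auto intro!: d(2) e(2))
    moreover have "\<bar>min d \<epsilon> / 2\<bar> < \<epsilon>" "\<bar>- (min e \<epsilon> / 2)\<bar> < \<epsilon>"
      using d(1) e(1) \<open>\<epsilon> > 0\<close> by auto
    ultimately show ?thesis by blast
  qed
  show "\<exists>x. \<bar>x\<bar> < \<epsilon> \<and> h x > 0" "\<exists>x. \<bar>x\<bar> < \<epsilon> \<and> h x < 0"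
    using pos[OF h(1,2)] pos[OF DERIV_minus[OF h(1)]] h(2,3) by (auto simp: neq_iff)
qed

lemma sgn_jacobi_curvature_chart_point:
  assumes m: "m \<in> mass_octant" and p: "p \<in> chart_domain"
  defines "A \<equiv> m $ 1 * m $ 2" and "B \<equiv> m $ 2 * m $ 3" and "C \<equiv> m $ 3 * m $ 1"
  shows "sgn (jacobi_curvature m (chart_point m p)) =
    sgn (curvature_numerator A B C ((norm (p - axis 1 1))\<^sup>2) ((norm p)\<^sup>2))"
proof -
  have pos: "A > 0" "B > 0" "C > 0" "m $ 1 * m $ 2 * m $ 3 > 0"
    using m by (auto simp: mass_octant_def A_def B_def C_def)
  have "chart_coord m (chart_point m p) = p"
    unfolding chart_coord_def
    using bij_betw_chart_point[OF m] p by (intro the_inv_into_f_f) (auto simp: bij_betw_def)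
  moreover have "jacobi_metric m = (\<lambda>p. (m $ 1 * m $ 2 * m $ 3
      * (inverse_sides A B C p / linear_sides A B C p)) *\<^sub>R mat 1)"
    using jacobi_metric_eq[OF m] by (auto simp: A_def B_def C_def)
  moreover have "inverse_sides A B C p > 0" "linear_sides A B C p > 0"
    using pos by (auto simp: inverse_sides_def linear_sides_def intro!: add_pos_nonneg)
  moreover have "sgn (2 * x / (k * (v ^ 3 * g))) = sgn x" if "k > 0" "v > 0" "g > 0" for k v g x :: real
    using that by (simp add: sgn_divide sgn_mult)
  ultimately show ?thesis
    unfolding jacobi_curvature_def using gauss_curvature_sides_metric[OF pos p] pos by simp
qed

lemma continuous_on_lift:
  assumes "m \<in> mass_octant"
  shows "continuous_on UNIV (lift m)"
proof -
  have "\<forall>i. continuous_on UNIV (\<lambda>p. triangle p $ i)" unfolding forall_3 by simp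
  then have "continuous_on UNIV (\<lambda>p. \<chi> i. triangle p $ i)" by (intro continuous_on_vec_lambda) blast
  then have "continuous_on UNIV triangle" by simp
  then have c: "continuous_on UNIV (\<lambda>p. centered m (triangle p))"
    unfolding centered_def by (intro continuous_on_vec_lambda continuous_intros)
  then have "continuous_on UNIV (\<lambda>p. inertia m (centered m (triangle p)))"
    unfolding inertia_def by (intro continuous_intros)
  with c show ?thesis
    unfolding lift_def Let_def using inertia_centered_triangle_pos[OF assms]
    by (intro continuous_intros) (auto simp: less_le)
qed

text \<open>Neighbourhoods in the quotient topology are pulled back to the chart through the continuous
  lift into the three-sphere.\<close>

lemma open_chart_preimage:
  assumes m: "m \<in> mass_octant" and N: "openin (shape_topology m) N"
  shows "open {p. chart_point m p \<in> N}"
proof -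
  obtain T where T: "open T" "{x \<in> config_sphere m. shape_of x \<in> N} = config_sphere m \<inter> T"
    using N by (auto simp: openin_shape_topology openin_open)
  have "{p. chart_point m p \<in> N} = lift m -` T"
    using T(2) lift_in_config_sphere[OF m] by (auto simp: chart_point_def)
  then show ?thesis
    using continuous_on_lift[OF m] T(1) by (simp add: open_vimage)
qed

text \<open>A rotation of the plane preserves the length of a vector, which is read off from
  \<open>inertia_rot\<close> for a configuration with all its mass in one body.\<close>

lemma norm_rot: "norm (rot \<theta> x $ i - rot \<theta> x $ j) = norm (x $ i - x $ j)"
proof -
  have "rot \<theta> x $ i - rot \<theta> x $ j = rot \<theta> (\<chi> _. x $ i - x $ j) $ k" for k
    by (simp add: rot_def vec_eq_iff forall_2 algebra_simps)
  moreover have "(norm (rot \<theta> (\<chi> _. v) $ 1))\<^sup>2 = (norm v)\<^sup>2" for v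
    using inertia_rot[of "axis 1 1" \<theta> "\<chi> _. v"] by (simp add: inertia_def sum_3 axis_def)
  ultimately show ?thesis by (metis norm_ge_zero power2_eq_imp_eq)
qed

text \<open>An equilateral configuration on the three-sphere has no coinciding bodies: one
  coincidence would force a total collision at the origin, of moment of inertia zero.\<close>

lemma lagrange_point_in_chart:
  assumes m: "m \<in> mass_octant" and L: "L \<in> lagrange_points m"
  obtains p where "p \<in> chart_domain" "L = chart_point m p" "norm p = 1" "norm (p - axis 1 1) = 1"
proof -
  obtain x where x: "x \<in> config_sphere m" "equilateral x" "L = shape_of x"
    using L by (auto simp: lagrange_points_def)
  have "\<not> collision x"
  proof
    assume "collision x"
    then have e: "x $ 1 = x $ 3" "x $ 2 = x $ 3"
      using x(2) by (auto simp: collision_def equilateral_def)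
    then have "(m $ 1 + m $ 2 + m $ 3) *\<^sub>R x $ 3 = 0"
      using x(1) by (simp add: config_sphere_def sum_3 algebra_simps)
    then have "x $ 3 = 0" using mass_sum_pos[OF m] by simp
    then show False using x(1) e by (simp add: config_sphere_def inertia_def sum_3)
  qed
  then have "L \<in> pants m" using x by (auto simp: pants_def)
  then obtain p where p: "p \<in> chart_domain" "L = chart_point m p"
    using bij_betw_chart_point[OF m] by (auto simp: bij_betw_def)
  have "lift m p \<in> shape_of x"
    using p(2) x(3) rot_0[of "lift m p"] unfolding chart_point_def
    by (metis rangeI shape_of_def)
  then obtain \<theta> where \<theta>: "lift m p = rot \<theta> x" by (auto simp: shape_of_def)
  obtain c where c: "c > 0"
    "\<And>i j. lift m p $ i - lift m p $ j = c *\<^sub>R (triangle p $ i - triangle p $ j)"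
    using lift_diff[OF m] by blast
  have "norm (x $ i - x $ j) = c * norm (triangle p $ i - triangle p $ j)" for i j
    using c(1) by (simp add: norm_rot[of \<theta> x, symmetric] c(2) flip: \<theta>)
  then have "norm p = 1" "norm (p - axis 1 1) = 1"
    using x(2) c(1) by (auto simp: equilateral_def dist_norm norm_minus_commute[of "axis 1 1"] norm_axis_1)
  with p show ?thesis by (rule that)
qed

text \<open>The genericity condition says that the curvature, which is zero at the Lagrange point, has nonzero
  derivative there along a path that changes \<open>s\<close> to first order and \<open>t\<close> only to second order.\<close>

lemma curvature_changes_sign_at_lagrange_point:
  assumes m: "m \<in> mass_octant" and L: "L \<in> lagrange_points m"
    and generic: "m $ 1 * ((m $ 2)\<^sup>2 + (m $ 3)\<^sup>2) \<noteq> m $ 2 * m $ 3 * (m $ 2 + m $ 3)"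
  shows "curvature_changes_sign_at m L"
  unfolding curvature_changes_sign_at_def
proof (intro allI impI)
  fix N assume N: "openin (shape_topology m) N \<and> L \<in> N"
  define A where "A = m $ 1 * m $ 2"
  define B where "B = m $ 2 * m $ 3"
  define C where "C = m $ 3 * m $ 1"
  have pos: "A > 0" "B > 0" "C > 0" using m by (auto simp: mass_octant_def A_def B_def C_def)
  obtain p where p: "p \<in> chart_domain" "L = chart_point m p" "norm p = 1" "norm (p - axis 1 1) = 1"
    using lagrange_point_in_chart[OF m L] .
  have p2: "(p $ 1)\<^sup>2 + (p $ 2)\<^sup>2 = 1" "(p $ 1 - 1)\<^sup>2 + (p $ 2)\<^sup>2 = 1"
    using power2_norm_vec_2[of p] power2_norm_vec_2[of "p - axis 1 1"] p(3,4) by (simp_all add: axis_def)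
  have y: "p $ 2 \<noteq> 0"
  proof
    assume "p $ 2 = 0"
    moreover have "p $ 1 = 1 / 2" using p2 by (simp add: power2_eq_square algebra_simps)
    then have "(p $ 1)\<^sup>2 = 1 / 4" by (simp only:) (simp add: power2_eq_square)
    ultimately show False using p2(1) by simp
  qed
  \<comment> \<open>A path through the Lagrange point perpendicular to the side from \<open>0\<close> to \<open>p\<close>: it keeps the length
    of that side to first order and changes the square of the other side at the rate \<open>2 p\<^sub>2\<close>.\<close>
  define \<gamma> where "\<gamma> x = p + x *\<^sub>R quarter_turn p" for x
  have sides: "(norm (\<gamma> x - axis 1 1))\<^sup>2 = 1 + 2 * p $ 2 * x + x\<^sup>2" "(norm (\<gamma> x))\<^sup>2 = 1 + x\<^sup>2" for x
  proof -
    have "(p $ 1 - x * p $ 2 - 1)\<^sup>2 + (p $ 2 + x * p $ 1)\<^sup>2 = 1 + 2 * p $ 2 * x + x\<^sup>2"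
      "(p $ 1 - x * p $ 2)\<^sup>2 + (p $ 2 + x * p $ 1)\<^sup>2 = 1 + x\<^sup>2"
      using p2 by algebra+
    then show "(norm (\<gamma> x - axis 1 1))\<^sup>2 = 1 + 2 * p $ 2 * x + x\<^sup>2" "(norm (\<gamma> x))\<^sup>2 = 1 + x\<^sup>2"
      unfolding power2_norm_vec_2 by (simp_all add: \<gamma>_def axis_def)
  qed
  let ?S = "chart_domain \<inter> {p. chart_point m p \<in> N}"
  have "open ?S" using open_chart_domain open_chart_preimage[OF m] N by (intro open_Int) auto
  then have "open (\<gamma> -` ?S)" unfolding \<gamma>_def by (intro open_vimage continuous_intros)
  moreover have "0 \<in> \<gamma> -` ?S" using N p by (simp add: \<gamma>_def)
  ultimately have "\<exists>\<epsilon>>0. \<forall>x. \<bar>x - 0\<bar> < \<epsilon> \<longrightarrow> x \<in> \<gamma> -` ?S"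
    unfolding open_real by blast
  then obtain \<epsilon> where \<epsilon>: "\<epsilon> > 0" "\<And>x. \<bar>x\<bar> < \<epsilon> \<Longrightarrow> \<gamma> x \<in> ?S"
    unfolding diff_zero vimage_eq by blast
  let ?h = "\<lambda>x. curvature_numerator A B C (1 + 2 * p $ 2 * x + x\<^sup>2) (1 + x\<^sup>2)"
  have "A\<^sup>2 + C\<^sup>2 - B * (A + C) = m $ 1 * (m $ 1 * ((m $ 2)\<^sup>2 + (m $ 3)\<^sup>2) - m $ 2 * m $ 3 * (m $ 2 + m $ 3))"
    by (simp add: A_def B_def C_def power2_eq_square algebra_simps)
  then have "4 * p $ 2 * (A + B + C) * B * (A\<^sup>2 + C\<^sup>2 - B * (A + C)) \<noteq> 0"
    using generic m[unfolded mass_octant_def] y pos by (auto simp: less_le)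
  note change = sign_change_at_simple_zero[OF curvature_numerator_derivative _ this \<epsilon>(1)]
  have sgn: "sgn (jacobi_curvature m (chart_point m (\<gamma> x))) = sgn (?h x)"
      and mem: "chart_point m (\<gamma> x) \<in> N \<inter> pants m" if "\<bar>x\<bar> < \<epsilon>" for x
    using sgn_jacobi_curvature_chart_point[OF m, of "\<gamma> x"] \<epsilon>(2)[OF that] bij_betw_chart_point[OF m]
    unfolding sides A_def B_def C_def by (auto simp: bij_betw_def)
  show "(\<exists>s \<in> N \<inter> pants m. jacobi_curvature m s > 0) \<and> (\<exists>s \<in> N \<inter> pants m. jacobi_curvature m s < 0)"
    using change curvature_numerator_lagrange sgn mem
    by (metis sgn_greater sgn_less zero_eq_power2 mult_zero_right add_0_right)
qed

theorem theorem6: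
  shows "\<exists>D \<subseteq> mass_octant. zariski_dense D \<and>
           (\<forall>m \<in> D. \<forall>L \<in> lagrange_points m. curvature_changes_sign_at m L)"
proof (intro exI conjI)
  let ?D = "{m \<in> mass_octant. m $ 1 * ((m $ 2)\<^sup>2 + (m $ 3)\<^sup>2) \<noteq> m $ 2 * m $ 3 * (m $ 2 + m $ 3)}"
  show "?D \<subseteq> mass_octant" by blast
  show "\<forall>m \<in> ?D. \<forall>L \<in> lagrange_points m. curvature_changes_sign_at m L"
    using curvature_changes_sign_at_lagrange_point by blast
  have inf: "infinite {a. vector [a, b, c] \<in> ?D}" if "b > 0" "c > 0" for b c :: real
  proof -
    have "b\<^sup>2 + c\<^sup>2 > 0" using that by (simp add: add_pos_pos)
    then have "{0<..} - {b * c * (b + c) / (b\<^sup>2 + c\<^sup>2)} \<subseteq> {a. vector [a, b, c] \<in> ?D}"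
      using that by (auto simp: mass_octant_def forall_3 field_simps)
    moreover have "infinite ({0<..} - {b * c * (b + c) / (b\<^sup>2 + c\<^sup>2)} :: real set)"
      by (simp add: infinite_Ioi)
    ultimately show ?thesis by (rule infinite_super)
  qed
  have "infinite {b. infinite {a. vector [a, b, c] \<in> ?D}}" if "c > 0" for c
    by (rule infinite_super[OF _ infinite_Ioi[of "0::real"]]) (use inf that in auto)
  then have "infinite {c. infinite {b. infinite {a. vector [a, b, c] \<in> ?D}}}"
    by (intro infinite_super[OF _ infinite_Ioi[of "0::real"]]) auto
  then show "zariski_dense ?D" by (rule zariski_dense_if_infinite_fibres)
qed

end
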